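(* For every cake-division instance with $n$ agents whose social graph is a tree of depth at most two, there exists a discrete protocol in the Robertson–Webb query model that finds a locally envy-free allocation using at most $O(n^3\log n)$ cut queries and $O(n^4\log n)$ evaluation queries.
   Context: The cake is $[0,1]$. Each agent $a_i$ has a valuation $v_i$ on finite unions of subintervals of $[0,1]$ that is non-negative, additive on disjoint pieces, non-atomic (for any $[x,y]$ and $\lambda\in[0,1]$ there is $y'$ with $v_i(x,y')=\lambda v_i(x,y)$), and normalized ($v_i(0,1)=1$). An allocation is a collection $\{A_1,\dots,A_n\}$ of pairwise disjoint pieces (each a finite union of intervals) whose union is $[0,1]$, with $A_i$ given to $a_i$. Given an undirected social graph $G$ on the agents, an allocation is locally envy-free if $v_i(A_i)\ge v_i(A_j)$ for every edge $(i,j)$ of $G$. In the Robertson–Webb query model the protocol accesses valuations only through cut queries $\texttt{cut}_i(x,\tau)$ (returns $y$ with $v_i(x,y)=\tau$) and evaluation queries $\texttt{eval}_i(x,y)$ (returns $v_i(x,y)$). A tree of depth at most two is a tree with a root such that every vertex is at distance at most two from the root. *)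

theory Defs
  imports Complex_Main
begin

text \<open>Cake [0,1]. A valuation is given by its values on intervals: v x y = value of [x,y]
  for 0 <= x <= y <= 1; its value on a finite union of intervals is the sum over the intervals.\<close>

definition valuation :: "(real \<Rightarrow> real \<Rightarrow> real) \<Rightarrow> bool" where
  "valuation v \<longleftrightarrow>
     (\<forall>x y. 0 \<le> x \<and> x \<le> y \<and> y \<le> 1 \<longrightarrow> 0 \<le> v x y) \<and>
     (\<forall>x y z. 0 \<le> x \<and> x \<le> y \<and> y \<le> z \<and> z \<le> 1 \<longrightarrow> v x z = v x y + v y z) \<and>
     (\<forall>x y l. 0 \<le> x \<and> x \<le> y \<and> y \<le> 1 \<and> 0 \<le> l \<and> l \<le> 1 \<longrightarrow>
        (\<exists>y'. x \<le> y' \<and> y' \<le> 1 \<and> v x y' = l * v x y)) \<and>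
     v 0 1 = 1"

definition graph_on :: "nat \<Rightarrow> (nat \<Rightarrow> nat \<Rightarrow> bool) \<Rightarrow> bool" where
  "graph_on n E \<longleftrightarrow> (\<forall>i j. E i j \<longrightarrow> i < n \<and> j < n \<and> i \<noteq> j \<and> E j i)"

definition connected_graph :: "nat \<Rightarrow> (nat \<Rightarrow> nat \<Rightarrow> bool) \<Rightarrow> bool" where
  "connected_graph n E \<longleftrightarrow> (\<forall>i j. i < n \<and> j < n \<longrightarrow> E\<^sup>*\<^sup>* i j)"

definition is_tree :: "nat \<Rightarrow> (nat \<Rightarrow> nat \<Rightarrow> bool) \<Rightarrow> bool" where
  "is_tree n E \<longleftrightarrow> graph_on n E \<and> connected_graph n E \<and>
     card {(i, j). i < j \<and> E i j} = n - 1"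

definition tree_depth_le2 :: "nat \<Rightarrow> (nat \<Rightarrow> nat \<Rightarrow> bool) \<Rightarrow> bool" where
  "tree_depth_le2 n E \<longleftrightarrow> is_tree n E \<and>
     (\<exists>r < n. \<forall>v < n. v = r \<or> E r v \<or> (\<exists>u. E r u \<and> E u v))"

text \<open>An allocation: cut points p_0 = 0 <= p_1 <= ... <= p_m = 1 and owners o_0..o_{m-1};
  segment [p_k, p_{k+1}] belongs to agent o_k. The piece A_i is the union of its segments.\<close>

definition valid_alloc :: "nat \<Rightarrow> real list \<Rightarrow> nat list \<Rightarrow> bool" where
  "valid_alloc n p ow \<longleftrightarrow> length p = Suc (length ow) \<and> p ! 0 = 0 \<and> last p = 1 \<and>
     sorted p \<and> (\<forall>k < length ow. ow ! k < n)"

definition piece_val :: "(real \<Rightarrow> real \<Rightarrow> real) \<Rightarrow> real list \<Rightarrow> nat list \<Rightarrow> nat \<Rightarrow> real" where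
  "piece_val v p ow j = (\<Sum>k < length ow. if ow ! k = j then v (p ! k) (p ! Suc k) else 0)"

definition locally_envy_free ::
  "nat \<Rightarrow> (nat \<Rightarrow> nat \<Rightarrow> bool) \<Rightarrow> (nat \<Rightarrow> real \<Rightarrow> real \<Rightarrow> real) \<Rightarrow> real list \<Rightarrow> nat list \<Rightarrow> bool" where
  "locally_envy_free n E vs p ow \<longleftrightarrow>
     (\<forall>i j. E i j \<longrightarrow> piece_val (vs i) p ow i \<ge> piece_val (vs i) p ow j)"

text \<open>Robertson-Webb protocols as (well-founded) query trees. CutQ i x t k asks cut_i(x,t) and
  continues with k applied to the answer; EvalQ i x y k asks eval_i(x,y). Between queries the
  protocol may compute arbitrarily (encoded in the continuation).\<close>

datatype protocol =
    Output "real list" "nat list"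
  | CutQ nat real real "real \<Rightarrow> protocol"
  | EvalQ nat real real "real \<Rightarrow> protocol"

text \<open>succeeds n E vs P c e: on valuation profile vs, every query P makes is well-formed and
  answerable, and for every sequence of oracle answers (cut answers chosen adversarially among all
  valid ones) P outputs a locally envy-free allocation using at most c cut queries and at most
  e evaluation queries.\<close>

primrec succeeds ::
  "nat \<Rightarrow> (nat \<Rightarrow> nat \<Rightarrow> bool) \<Rightarrow> (nat \<Rightarrow> real \<Rightarrow> real \<Rightarrow> real) \<Rightarrow> protocol \<Rightarrow> real \<Rightarrow> real \<Rightarrow> bool" where
  "succeeds n E vs (Output p ow) c e \<longleftrightarrow> valid_alloc n p ow \<and> locally_envy_free n E vs p ow"
| "succeeds n E vs (CutQ i x t k) c e \<longleftrightarrow> 1 \<le> c \<and> i < n \<and> 0 \<le> x \<and> x \<le> 1 \<and>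
     (\<exists>y. x \<le> y \<and> y \<le> 1 \<and> vs i x y = t) \<and>
     (\<forall>y. x \<le> y \<and> y \<le> 1 \<and> vs i x y = t \<longrightarrow> succeeds n E vs (k y) (c - 1) e)"
| "succeeds n E vs (EvalQ i x y k) c e \<longleftrightarrow> 1 \<le> e \<and> i < n \<and> 0 \<le> x \<and> x \<le> y \<and> y \<le> 1 \<and>
     succeeds n E vs (k (vs i x y)) c (e - 1)"

end

theory Submission
  imports Defs "HOL-Library.Disjoint_Sets"
begin

text \<open>
  Let r be the root; the other agents fall into groups, each consisting of a neighbour h of r
  (the head) and its leaves. In one round, r cuts the remaining cake into n pieces of equal value.
  The other agents choose pieces one after the other, every agent on behalf of the head of its
  group; r gets the last piece R, and all other pieces are trimmed to the value that R has
  for the head concerned. Within a group the head is now indifferent between all pieces and R, and r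
  envies nobody whichever piece of the group the head gets. So the pieces of a group may
  be redistributed inside the group, later and separately for each round.

  A round shrinks the remaining cake by the factor 1 - 1/n in the eyes of r, and one of its pieces
  b was trimmed by at least 1/(n - 1) of what remains afterwards. If the head of the group of b
  obtains b in one of the first n rounds, then after n ln n further rounds r's advantage over this
  head exceeds the value of everything that is left, so that the rest can be divided within
  that group.

  By the pigeonhole principle some group contains b in more rounds than it has members. Forcing the
  head to take b in one of these rounds may make leaves envious in that round, but by a deficit
  that is at most the gain a leaf can have over the head when the same round is played differently.
  So every leaf can be given a round of its own as compensation, and one
  round with smaller deficits for all leaves is left for the head.
\<close>

subsection \<open>Assigning objects around a star\<close>

lemma bij_betw_fun_upd_insert:
  assumes "bij_betw f A B" "a \<notin> A" "b \<notin> B"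
  shows "bij_betw (f(a := b)) (insert a A) (insert b B)"
proof -
  have "bij_betw (f(a := b)) A B"
    using assms(1,2) by (subst bij_betw_cong[where g = f]) auto
  moreover have "bij_betw (f(a := b)) {a} {b}" by (simp add: bij_betw_def)
  ultimately have "bij_betw (f(a := b)) (A \<union> {a}) (B \<union> {b})"
    using assms(3) by (intro bij_betw_combine) auto
  then show ?thesis by simp
qed

lemma obtain_maximizer:
  fixes f :: "'a \<Rightarrow> real"
  assumes "finite S" "S \<noteq> {}"
  obtains s where "s \<in> S" "\<And>s'. s' \<in> S \<Longrightarrow> f s' \<le> f s"
proof -
  have "Max (f ` S) \<in> f ` S" using assms by simp
  then obtain s where "s \<in> S" "f s = Max (f ` S)" by auto
  then show ?thesis using assms by (intro that[of s]) auto
qed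

text \<open>Let the members of \<open>L\<close> take their favourites one after the other and leave
  the last object to \<open>c\<close>. That object was still available at every choice, so nobody in
  \<open>L\<close> prefers it.\<close>

lemma sequential_choice:
  fixes u :: "'a \<Rightarrow> 'b \<Rightarrow> real"
  assumes "finite L" "c \<notin> L" "card S = Suc (card L)"
  shows "\<exists>\<sigma>. bij_betw \<sigma> (insert c L) S \<and> (\<forall>l\<in>L. u l (\<sigma> c) \<le> u l (\<sigma> l))"
  using assms
proof (induction L arbitrary: S rule: finite_induct)
  case empty
  then obtain s where "S = {s}" by (auto simp: card_Suc_eq)
  then show ?case by (intro exI[of _ "\<lambda>_. s"]) (auto simp: bij_betw_def)
next
  case (insert l L)
  have fin: "finite S" "S \<noteq> {}"
    using insert.prems(2) by (auto intro: card_ge_0_finite)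
  obtain s where s: "s \<in> S" "\<And>s'. s' \<in> S \<Longrightarrow> u l s' \<le> u l s"
    using obtain_maximizer[OF fin, of "u l"] by metis
  have "card (S - {s}) = Suc (card L)" using insert fin s by simp
  then obtain \<sigma> where \<sigma>: "bij_betw \<sigma> (insert c L) (S - {s})" "\<forall>l\<in>L. u l (\<sigma> c) \<le> u l (\<sigma> l)"
    using insert.IH[of "S - {s}"] insert.prems by auto
  have "bij_betw (\<sigma>(l := s)) (insert l (insert c L)) (insert s (S - {s}))"
    using \<sigma>(1) insert by (intro bij_betw_fun_upd_insert) auto
  then have "bij_betw (\<sigma>(l := s)) (insert c (insert l L)) S"
    using s(1) by (simp add: insert_commute insert_absorb)
  moreover have "u l (\<sigma> c) \<le> u l s"
    using s(2) bij_betwE[OF \<sigma>(1)] by auto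
  then have "\<forall>k\<in>insert l L. u k ((\<sigma>(l := s)) c) \<le> u k ((\<sigma>(l := s)) k)"
    using \<sigma>(2) insert by auto
  ultimately show ?case by blast
qed

text \<open>If \<^term>\<open>l\<close> leaves and \<^term>\<open>c\<close> enters as the last to choose, then \<^term>\<open>c\<close> ends up with an object that was still
  available when \<^term>\<open>l\<close> made its choice, hence with one that \<^term>\<open>l\<close> likes no better than its own.\<close>

lemma sequential_choice_displaced:
  fixes u :: "'a \<Rightarrow> 'b \<Rightarrow> real"
  assumes "finite L" "c \<notin> L" "finite S" "card S = card L"
  shows "\<exists>\<pi>. bij_betw \<pi> L S \<and>
    (\<forall>l\<in>L. \<exists>\<sigma>. bij_betw \<sigma> (insert c (L - {l})) S \<and>
       (\<forall>k\<in>L - {l}. u k (\<sigma> c) \<le> u k (\<sigma> k)) \<and> u l (\<sigma> c) \<le> u l (\<pi> l))"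
  using assms
proof (induction L arbitrary: S rule: finite_induct)
  case empty
  then show ?case by (auto simp: bij_betw_def)
next
  case (insert a L)
  have ne: "S \<noteq> {}" using insert by auto
  obtain s where s: "s \<in> S" "\<And>s'. s' \<in> S \<Longrightarrow> u a s' \<le> u a s"
    using obtain_maximizer[OF insert.prems(2) ne, of "u a"] by metis
  have "card (S - {s}) = card L" using insert s by simp
  then obtain \<pi> where \<pi>: "bij_betw \<pi> L (S - {s})"
    and ex: "\<And>l. l \<in> L \<Longrightarrow> \<exists>\<sigma>. bij_betw \<sigma> (insert c (L - {l})) (S - {s}) \<and>
       (\<forall>k\<in>L - {l}. u k (\<sigma> c) \<le> u k (\<sigma> k)) \<and> u l (\<sigma> c) \<le> u l (\<pi> l)"
    using insert.IH[of "S - {s}"] insert.prems by auto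
  have bij: "bij_betw (\<pi>(a := s)) (insert a L) S"
    using bij_betw_fun_upd_insert[OF \<pi>, of a s] insert s by (simp add: insert_absorb)
  moreover have "\<exists>\<sigma>. bij_betw \<sigma> (insert c (insert a L - {l})) S \<and>
       (\<forall>k\<in>insert a L - {l}. u k (\<sigma> c) \<le> u k (\<sigma> k)) \<and> u l (\<sigma> c) \<le> u l ((\<pi>(a := s)) l)"
    if l: "l \<in> insert a L" for l
  \<comment> \<open>\<open>a\<close> chooses first. If \<open>a\<close> itself leaves, its favourite
    \<open>s\<close> returns to the pool and the others choose from all of \<open>S\<close>;
    otherwise \<open>a\<close> still takes \<open>s\<close> and the induction hypothesis handles the
    rest.\<close>
  proof (cases "l = a")
    case True
    have "card S = Suc (card L)" using insert by simp
    then obtain \<sigma> where \<sigma>: "bij_betw \<sigma> (insert c L) S" "\<forall>k\<in>L. u k (\<sigma> c) \<le> u k (\<sigma> k)"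
      using sequential_choice[of L c S u] insert by auto
    have "u a (\<sigma> c) \<le> u a s" using s(2) bij_betwE[OF \<sigma>(1)] by auto
    then show ?thesis using \<sigma> True insert by (intro exI[of _ \<sigma>]) auto
  next
    case False
    then obtain \<sigma> where \<sigma>: "bij_betw \<sigma> (insert c (L - {l})) (S - {s})"
       "\<forall>k\<in>L - {l}. u k (\<sigma> c) \<le> u k (\<sigma> k)" "u l (\<sigma> c) \<le> u l (\<pi> l)"
      using ex[of l] l by auto
    have eq: "insert a (insert c (L - {l})) = insert c (insert a L - {l})"
      using False by auto
    have "a \<notin> insert c (L - {l})" using insert by auto
    then have "bij_betw (\<sigma>(a := s)) (insert c (insert a L - {l})) S"
      using bij_betw_fun_upd_insert[OF \<sigma>(1), of a s] s(1) eq by (simp add: insert_absorb)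
    moreover have "u a (\<sigma> c) \<le> u a s" using s(2) bij_betwE[OF \<sigma>(1)] by auto
    ultimately show ?thesis
      using \<sigma> False insert by (intro exI[of _ "\<sigma>(a := s)"]) auto
  qed
  ultimately show ?case by blast
qed

text \<open>Handing \<^term>\<open>b\<close> to \<^term>\<open>c\<close> costs each \<^term>\<open>l\<close> no more than what \<^term>\<open>l\<close> can gain over \<^term>\<open>c\<close> in
  some other, envy-free assignment of the same objects. This is what makes exchanges between
  rounds possible.\<close>

lemma forced_choice:
  fixes u :: "'a \<Rightarrow> 'b \<Rightarrow> real"
  assumes "finite L" "c \<notin> L" "card S = Suc (card L)" "b \<in> S"
  shows "\<exists>\<pi>. bij_betw \<pi> (insert c L) S \<and> \<pi> c = b \<and>
    (\<forall>l\<in>L. \<exists>\<sigma>. bij_betw \<sigma> (insert c L) S \<and> (\<forall>k\<in>L. u k (\<sigma> c) \<le> u k (\<sigma> k)) \<and>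
       u l b - u l (\<pi> l) \<le> u l (\<sigma> l) - u l (\<sigma> c))"
proof -
  have fin: "finite S" using assms(3) by (auto intro: card_ge_0_finite)
  then have "card (S - {b}) = card L" using assms by simp
  from sequential_choice_displaced[OF assms(1,2) _ this, of u] fin
  obtain \<pi> where \<pi>: "bij_betw \<pi> L (S - {b})"
    and ex: "\<And>l. l \<in> L \<Longrightarrow> \<exists>\<sigma>. bij_betw \<sigma> (insert c (L - {l})) (S - {b}) \<and>
       (\<forall>k\<in>L - {l}. u k (\<sigma> c) \<le> u k (\<sigma> k)) \<and> u l (\<sigma> c) \<le> u l (\<pi> l)" by auto
  have "bij_betw (\<pi>(c := b)) (insert c L) S"
    using bij_betw_fun_upd_insert[OF \<pi>, of c b] assms by (simp add: insert_absorb)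
  moreover have "\<exists>\<sigma>. bij_betw \<sigma> (insert c L) S \<and> (\<forall>k\<in>L. u k (\<sigma> c) \<le> u k (\<sigma> k)) \<and>
       u l b - u l ((\<pi>(c := b)) l) \<le> u l (\<sigma> l) - u l (\<sigma> c)" if l: "l \<in> L" for l
  \<comment> \<open>If \<open>l\<close> likes \<open>b\<close> at least as much as its own object,
    then \<open>l\<close> is given \<open>b\<close> and \<open>c\<close> enters as the last to
    choose from \<open>S - {b}\<close>; the gain over \<open>c\<close> is at least the deficit.
    Otherwise the deficit is negative and any sequential choice will do.\<close>
  proof (cases "u l b \<ge> u l (\<pi> l)")
    case True
    obtain \<sigma> where \<sigma>: "bij_betw \<sigma> (insert c (L - {l})) (S - {b})"
       "\<forall>k\<in>L - {l}. u k (\<sigma> c) \<le> u k (\<sigma> k)" "u l (\<sigma> c) \<le> u l (\<pi> l)"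
      using ex[OF l] by auto
    have eq: "insert l (insert c (L - {l})) = insert c L" using l by auto
    have "l \<noteq> c" using l assms by auto
    then have "bij_betw (\<sigma>(l := b)) (insert c L) S"
      using bij_betw_fun_upd_insert[OF \<sigma>(1), of l b] assms eq by (simp add: insert_absorb)
    then show ?thesis
      using \<sigma> True \<open>l \<noteq> c\<close> l assms by (intro exI[of _ "\<sigma>(l := b)"]) auto
  next
    case False
    obtain \<sigma> where "bij_betw \<sigma> (insert c L) S" "\<forall>k\<in>L. u k (\<sigma> c) \<le> u k (\<sigma> k)"
      using sequential_choice[OF assms(1-3), of u] by auto
    then show ?thesis
      using False l assms by (intro exI[of _ \<sigma>]) force
  qed
  ultimately show ?thesis by (intro exI[of _ "\<pi>(c := b)"]) auto
qed

text \<open>Greedy reservation: each member in turn reserves the remaining round with the largest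
  \<open>D\<close>. Since there are more rounds than members, some round is left over, and it was
  available to everyone who chose.\<close>

lemma distinct_dominating_rounds:
  fixes D :: "'a \<Rightarrow> 'r \<Rightarrow> real"
  assumes "finite L" "finite T" "card L < card T"
  shows "\<exists>s t. inj_on s L \<and> s ` L \<subseteq> T \<and> t \<in> T - s ` L \<and> (\<forall>l\<in>L. D l t \<le> D l (s l))"
  using assms
proof (induction L arbitrary: T rule: finite_induct)
  case empty
  then show ?case by (auto simp: card_gt_0_iff)
next
  case (insert a L)
  then have "T \<noteq> {}" by auto
  then obtain m where m: "m \<in> T" "\<And>t. t \<in> T \<Longrightarrow> D a t \<le> D a m"
    using obtain_maximizer[OF insert.prems(1), of "D a"] by metis
  have "card L < card (T - {m})" using insert m by simp
  then obtain s t where st: "inj_on s L" "s ` L \<subseteq> T - {m}" "t \<in> T - {m} - s ` L"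
      "\<forall>l\<in>L. D l t \<le> D l (s l)"
    using insert.IH[of "T - {m}"] insert.prems by auto
  have img: "(s(a := m)) ` L = s ` L" using insert by auto
  have inj: "inj_on (s(a := m)) (insert a L)"
    using st insert(2) by (auto simp: inj_on_def)
  show ?case
  proof (intro exI conjI)
    show "inj_on (s(a := m)) (insert a L)" by fact
    show "(s(a := m)) ` insert a L \<subseteq> T" "t \<in> T - (s(a := m)) ` insert a L"
      using st(2,3) m(1) img by auto
    show "\<forall>l\<in>insert a L. D l t \<le> D l ((s(a := m)) l)"
      using st(3,4) m(2) insert(2) by auto
  qed
qed

text \<open>Each \<^term>\<open>l\<close> gets its own compensation round, of larger scale than the round in which \<^term>\<open>c\<close> is
  forced to take \<^term>\<open>b t\<close>.\<close>

lemma star_exchange: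
  fixes u :: "'a \<Rightarrow> 'r \<Rightarrow> 'b \<Rightarrow> real"
  assumes L: "finite L" "c \<notin> L" and T: "finite T" "T' \<subseteq> T" "card L < card T'"
    and S: "card S = Suc (card L)" and b: "\<And>t. t \<in> T' \<Longrightarrow> b t \<in> S"
  shows "\<exists>p. (\<forall>t. bij_betw (p t) (insert c L) S) \<and>
     (\<forall>l\<in>L. (\<Sum>t\<in>T. u l t (p t c)) \<le> (\<Sum>t\<in>T. u l t (p t l))) \<and> (\<exists>t\<in>T'. p t c = b t)"
proof -
  have "\<exists>\<pi>. bij_betw \<pi> (insert c L) S \<and> \<pi> c = b t \<and>
    (\<forall>l\<in>L. \<exists>\<sigma>. bij_betw \<sigma> (insert c L) S \<and> (\<forall>k\<in>L. u k t (\<sigma> c) \<le> u k t (\<sigma> k)) \<and>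
       u l t (b t) - u l t (\<pi> l) \<le> u l t (\<sigma> l) - u l t (\<sigma> c))" if "t \<in> T'" for t
    using forced_choice[OF L S b[OF that], of "\<lambda>l. u l t"] by simp
  then obtain \<pi> where \<pi>: "\<And>t. t \<in> T' \<Longrightarrow> bij_betw (\<pi> t) (insert c L) S"
      "\<And>t. t \<in> T' \<Longrightarrow> \<pi> t c = b t"
    and "\<And>t. t \<in> T' \<Longrightarrow> \<forall>l\<in>L. \<exists>\<sigma>. bij_betw \<sigma> (insert c L) S \<and> (\<forall>k\<in>L. u k t (\<sigma> c) \<le> u k t (\<sigma> k)) \<and>
       u l t (b t) - u l t (\<pi> t l) \<le> u l t (\<sigma> l) - u l t (\<sigma> c)"
    by metis
  then obtain \<sigma> where \<sigma>: "\<And>t l. t \<in> T' \<Longrightarrow> l \<in> L \<Longrightarrow> bij_betw (\<sigma> t l) (insert c L) S"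
      "\<And>t l k. t \<in> T' \<Longrightarrow> l \<in> L \<Longrightarrow> k \<in> L \<Longrightarrow> u k t (\<sigma> t l c) \<le> u k t (\<sigma> t l k)"
      "\<And>t l. t \<in> T' \<Longrightarrow> l \<in> L \<Longrightarrow> u l t (b t) - u l t (\<pi> t l) \<le> u l t (\<sigma> t l l) - u l t (\<sigma> t l c)"
    by metis
  have "\<exists>\<rho>. bij_betw \<rho> (insert c L) S \<and> (\<forall>l\<in>L. u l t (\<rho> c) \<le> u l t (\<rho> l))" for t
    using sequential_choice[OF L S, of "\<lambda>l. u l t"] by simp
  then obtain \<rho> where \<rho>: "\<And>t. bij_betw (\<rho> t) (insert c L) S"
      "\<And>t l. l \<in> L \<Longrightarrow> u l t (\<rho> t c) \<le> u l t (\<rho> t l)"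
    by metis
  define D where "D l t = u l t (b t) - u l t (\<pi> t l)" for l t
  obtain s t0 where s: "inj_on s L" "s ` L \<subseteq> T'" "t0 \<in> T' - s ` L" "\<forall>l\<in>L. D l t0 \<le> D l (s l)"
    using distinct_dominating_rounds[OF L(1) finite_subset[OF T(2,1)] T(3), of D] by auto
  \<comment> \<open>Round \<open>t0\<close> is the forced one, round \<open>s l\<close> is played in
    favour of \<open>l\<close>, and every other round is a plain sequential choice. Only
    \<open>t0\<close> can produce envy, and round \<open>s l\<close> repays it since
    \<open>D l t0 \<le> D l (s l)\<close>.\<close>
  define p where "p t = (if t = t0 then \<pi> t else if t \<in> s ` L then \<sigma> t (inv_into L s t) else \<rho> t)" for t
  have inv: "inv_into L s t \<in> L" if "t \<in> s ` L" for t using that by (rule inv_into_into)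
  have "bij_betw (p t) (insert c L) S" for t
    using \<pi>(1) \<sigma>(1) \<rho>(1) s inv by (auto simp: p_def)
  moreover have "p t0 c = b t0" using s \<pi>(2) by (auto simp: p_def)
  moreover have "(\<Sum>t\<in>T. u l t (p t c)) \<le> (\<Sum>t\<in>T. u l t (p t l))" if l: "l \<in> L" for l
  proof -
    define g where "g t = u l t (p t l) - u l t (p t c)" for t
    have nn: "0 \<le> g t" if "t \<noteq> t0" for t
      using that \<sigma>(2)[of t "inv_into L s t" l] \<rho>(2)[of l t] inv[of t] l s(2)
      by (auto simp: g_def p_def)
    have "s l \<noteq> t0" "t0 \<in> T" "s l \<in> T" using s T l by auto
    have "g t0 = - D l t0" using s \<pi>(2) by (auto simp: g_def p_def D_def)
    moreover have "g (s l) \<ge> D l (s l)"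
      using \<sigma>(3)[of "s l" l] s l \<open>s l \<noteq> t0\<close> by (auto simp: g_def p_def D_def)
    ultimately have "0 \<le> g t0 + g (s l)" using s(4) l by force
    also have "\<dots> \<le> g t0 + (\<Sum>t\<in>T - {t0}. g t)"
      using nn \<open>s l \<noteq> t0\<close> \<open>s l \<in> T\<close> T(1) by (intro add_left_mono member_le_sum) auto
    also have "\<dots> = (\<Sum>t\<in>T. g t)" using T(1) \<open>t0 \<in> T\<close> by (simp add: sum.remove[of T t0])
    finally show ?thesis by (simp add: g_def sum_subtractf)
  qed
  ultimately show ?thesis using s(3) by blast
qed

subsection \<open>Pieces and their values\<close>

text \<open>The cumulative function \<open>v 0\<close> of a valuation. Attaining every level between
  0 and 1 expresses non-atomicity; for a monotone function it amounts to continuity.\<close>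

definition cdf :: "(real \<Rightarrow> real) \<Rightarrow> bool" where
  "cdf f \<longleftrightarrow> f 0 = 0 \<and> f 1 = 1 \<and> (\<forall>x y. 0 \<le> x \<and> x \<le> y \<and> y \<le> 1 \<longrightarrow> f x \<le> f y) \<and>
     (\<forall>t. 0 \<le> t \<and> t \<le> 1 \<longrightarrow> (\<exists>y. 0 \<le> y \<and> y \<le> 1 \<and> f y = t))"

lemma cdf_mono: "cdf f \<Longrightarrow> 0 \<le> x \<Longrightarrow> x \<le> y \<Longrightarrow> y \<le> 1 \<Longrightarrow> f x \<le> f y"
  by (simp add: cdf_def)

definition marks :: "real set \<Rightarrow> bool" where
  "marks P \<longleftrightarrow> finite P \<and> 0 \<in> P \<and> 1 \<in> P \<and> P \<subseteq> {0..1}"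

definition prev_mark :: "real set \<Rightarrow> real \<Rightarrow> real" where
  "prev_mark P p = Max {q \<in> P. q < p}"

text \<open>A union of half-open cells \<open>(p, q]\<close> between consecutive marks, expressed as
  invariance under moving a point within its cell. Half-open cells let pieces be disjoint as sets
  and still cover \<open>{0<..1}\<close> exactly.\<close>

definition piece :: "real set \<Rightarrow> real set \<Rightarrow> bool" where
  "piece P A \<longleftrightarrow> A \<subseteq> {0<..1} \<and>
     (\<forall>x\<in>A. \<forall>y\<in>{0<..1}. (\<forall>p\<in>P. x \<le> p \<longleftrightarrow> y \<le> p) \<longrightarrow> y \<in> A)"

text \<open>Each cell between consecutive marks is represented by its right end point.\<close>

definition val :: "(real \<Rightarrow> real) \<Rightarrow> real set \<Rightarrow> real set \<Rightarrow> real" where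
  "val f P A = (\<Sum>p\<in>P \<inter> A. f p - f (prev_mark P p))"

lemma piece_subset: "piece P A \<Longrightarrow> A \<subseteq> {0<..1}"
  by (simp add: piece_def)

lemma pieceI:
  assumes "A \<subseteq> {0<..1}"
    "\<And>x y. x \<in> A \<Longrightarrow> 0 < y \<Longrightarrow> y \<le> 1 \<Longrightarrow> (\<And>p. p \<in> P \<Longrightarrow> x \<le> p \<longleftrightarrow> y \<le> p) \<Longrightarrow> y \<in> A"
  shows "piece P A"
  using assms unfolding piece_def by simp

lemma pieceD:
  assumes "piece P A" "x \<in> A" "0 < y" "y \<le> 1" "\<And>p. p \<in> P \<Longrightarrow> x \<le> p \<longleftrightarrow> y \<le> p"
  shows "y \<in> A"
  using assms unfolding piece_def by auto

lemma piece_empty: "piece P {}"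
  by (simp add: piece_def)

lemma piece_whole: "piece P {0<..1}"
  by (simp add: piece_def)

lemma piece_Diff: "piece P A \<Longrightarrow> piece P B \<Longrightarrow> piece P (A - B)"
  unfolding piece_def by blast

lemma piece_Int: "piece P A \<Longrightarrow> piece P B \<Longrightarrow> piece P (A \<inter> B)"
  unfolding piece_def by blast

lemma piece_Un: "piece P A \<Longrightarrow> piece P B \<Longrightarrow> piece P (A \<union> B)"
  unfolding piece_def by blast

lemma piece_UN: "(\<And>i. i \<in> I \<Longrightarrow> piece P (A i)) \<Longrightarrow> piece P (\<Union>i\<in>I. A i)"
  unfolding piece_def[of P "\<Union>i\<in>I. A i"]
proof (intro conjI ballI impI)
  fix x y
  assume A: "\<And>i. i \<in> I \<Longrightarrow> piece P (A i)" and "x \<in> (\<Union>i\<in>I. A i)"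
    and y: "y \<in> {0<..1}" "\<forall>p\<in>P. (x \<le> p) = (y \<le> p)"
  then obtain i where "i \<in> I" "x \<in> A i" by blast
  then have "y \<in> A i" using pieceD[OF A, of i x y] y by auto
  then show "y \<in> (\<Union>i\<in>I. A i)" using \<open>i \<in> I\<close> by blast
qed (use piece_subset in blast)

lemma piece_upto: "y \<in> P \<Longrightarrow> y \<le> 1 \<Longrightarrow> piece P {0<..y}"
  by (rule pieceI) auto

lemma piece_mono: "piece P A \<Longrightarrow> P \<subseteq> P' \<Longrightarrow> piece P' A"
  by (rule pieceI) (use piece_subset pieceD in \<open>blast+\<close>)

lemma prev_mark:
  assumes "marks P" "0 < p"
  shows "prev_mark P p \<in> P" "prev_mark P p < p" "q \<in> P \<Longrightarrow> q < p \<Longrightarrow> q \<le> prev_mark P p"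
proof -
  have fin: "finite {q \<in> P. q < p}" "{q \<in> P. q < p} \<noteq> {}"
    using assms by (auto simp: marks_def)
  show "prev_mark P p \<in> P" "prev_mark P p < p"
    using Max_in[OF fin] by (auto simp: prev_mark_def)
  show "q \<in> P \<Longrightarrow> q < p \<Longrightarrow> q \<le> prev_mark P p"
    using fin by (auto simp: prev_mark_def)
qed

lemma prev_mark_eqI:
  assumes "finite P" "q \<in> P" "q < p" "\<And>q'. q' \<in> P \<Longrightarrow> q' < p \<Longrightarrow> q' \<le> q"
  shows "prev_mark P p = q"
  unfolding prev_mark_def using assms by (intro Max_eqI) auto

lemma val_Un:
  assumes "marks P" "A \<inter> B = {}"
  shows "val f P (A \<union> B) = val f P A + val f P B"
  unfolding val_def Int_Un_distrib using assms
  by (intro sum.union_disjoint) (auto simp: marks_def)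

lemma val_empty: "val f P {} = 0"
  by (simp add: val_def)

lemma val_UN:
  assumes "marks P" "finite I" "\<And>i j. i \<in> I \<Longrightarrow> j \<in> I \<Longrightarrow> i \<noteq> j \<Longrightarrow> A i \<inter> A j = {}"
  shows "val f P (\<Union>i\<in>I. A i) = (\<Sum>i\<in>I. val f P (A i))"
  using assms(2,3)
proof (induction I rule: finite_induct)
  case (insert i I)
  then have "A i \<inter> (\<Union>j\<in>I. A j) = {}" by fastforce
  with insert show ?case by (simp add: val_Un[OF assms(1)])
qed (simp add: val_empty)

lemma val_nonneg:
  assumes "marks P" "cdf f" "piece P A"
  shows "0 \<le> val f P A"
  unfolding val_def
proof (rule sum_nonneg)
  fix p assume p: "p \<in> P \<inter> A"
  then have "0 < p" "p \<le> 1" using assms(3) by (auto simp: piece_def)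
  then have "prev_mark P p \<in> P" "prev_mark P p < p" using prev_mark[OF assms(1)] by auto
  then have "f (prev_mark P p) \<le> f p"
    using assms(1,2) \<open>p \<le> 1\<close> by (auto simp: cdf_def marks_def subset_iff)
  then show "0 \<le> f p - f (prev_mark P p)" by simp
qed

lemma val_Diff:
  assumes "marks P" "B \<subseteq> A"
  shows "val f P (A - B) = val f P A - val f P B"
proof -
  have "(A - B) \<inter> B = {}" "(A - B) \<union> B = A" using assms(2) by auto
  then show ?thesis using val_Un[OF assms(1), of "A - B" B f] by simp
qed

lemma val_mono:
  assumes "marks P" "cdf f" "piece P A" "piece P B" "B \<subseteq> A"
  shows "val f P B \<le> val f P A"
  using val_Diff[OF assms(1,5), of f] val_nonneg[OF assms(1,2) piece_Diff[OF assms(3,4)]] by simp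

text \<open>The new mark splits one cell in two, which lie both inside \<open>A\<close> or both
  outside, and the two increments of \<open>f\<close> telescope to the old one.\<close>

lemma val_insert_mark:
  assumes P: "marks P" and y: "0 \<le> y" "y \<le> 1" and A: "piece P A"
  shows "val f (insert y P) A = val f P A"
proof (cases "y \<in> P")
  case True
  then show ?thesis by (simp add: insert_absorb)
next
  case False
  have fin: "finite P" and 01: "0 \<in> P" "1 \<in> P" using P by (auto simp: marks_def)
  have y': "0 < y" "y < 1" using False y 01 by (metis less_eq_real_def)+
  \<comment> \<open>\<open>b\<close> is the right end of the cell that contains \<open>y\<close>,
    the only old mark whose predecessor changes.\<close>
  define b where "b = Min {p \<in> P. y < p}"
  have finb: "finite {p \<in> P. y < p}" "{p \<in> P. y < p} \<noteq> {}" using fin 01 y' by auto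
  have b: "b \<in> P" "y < b" using Min_in[OF finb] by (auto simp: b_def)
  have bmin: "b \<le> p" if "p \<in> P" "y < p" for p
    using finb that by (auto simp: b_def)
  have b1: "b \<le> 1" using bmin 01 y' by auto
  let ?P = "insert y P"
  have prev_b: "prev_mark ?P b = y"
    using fin b bmin by (intro prev_mark_eqI) force+
  have prev_y: "prev_mark ?P y = prev_mark P b"
  proof (rule prev_mark_eqI)
    have in_P: "prev_mark P b \<in> P" "prev_mark P b < b"
      using prev_mark(1,2)[OF P, of b] b y' by auto
    then have "prev_mark P b \<noteq> y" "\<not> y < prev_mark P b"
      using False bmin[of "prev_mark P b"] by auto
    then show "prev_mark P b < y" by simp
    show "q' \<le> prev_mark P b" if "q' \<in> insert y P" "q' < y" for q'
      using that prev_mark(3)[OF P, of b q'] b y' by auto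
  qed (use fin b y' prev_mark(1)[OF P] in auto)
  have prev_other: "prev_mark ?P p = prev_mark P p" if p: "p \<in> P" "p \<noteq> b" "0 < p" for p
  proof (rule prev_mark_eqI)
    show "q' \<le> prev_mark P p" if "q' \<in> insert y P" "q' < p" for q'
    proof (cases "q' = y")
      case True
      then have "b \<le> p" using that p bmin by auto
      then show ?thesis using prev_mark(3)[OF P, of p b] p b True by auto
    qed (use that prev_mark(3)[OF P p(3)] in auto)
  qed (use fin p prev_mark(1,2)[OF P] in auto)
  have same: "(\<forall>p\<in>P. y \<le> p \<longleftrightarrow> b \<le> p)"
    using bmin b False by force
  have iff: "y \<in> A \<longleftrightarrow> b \<in> A"
  proof
    assume "y \<in> A"
    then show "b \<in> A" using same b y' b1 by (intro pieceD[OF A, of y b]) auto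
  next
    assume "b \<in> A"
    then show "y \<in> A" using same y' by (intro pieceD[OF A, of b y]) auto
  qed
  have pos: "0 < p" if "p \<in> A" for p using that A by (auto simp: piece_def)
  show ?thesis
  proof (cases "y \<in> A")
    case True
    have "val f ?P A = f y - f (prev_mark ?P y) + (\<Sum>p\<in>P \<inter> A. f p - f (prev_mark ?P p))"
      using True fin False by (simp add: val_def Int_insert_left)
    also have "(\<Sum>p\<in>P \<inter> A. f p - f (prev_mark ?P p)) =
        f b - f y + (\<Sum>p\<in>P \<inter> A - {b}. f p - f (prev_mark ?P p))"
      using True fin b iff prev_b by (subst sum.remove[of _ b]) auto
    also have "(\<Sum>p\<in>P \<inter> A - {b}. f p - f (prev_mark ?P p)) =
        (\<Sum>p\<in>P \<inter> A - {b}. f p - f (prev_mark P p))"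
      using prev_other pos by (intro sum.cong) auto
    also have "f y - f (prev_mark ?P y) + (f b - f y + \<dots>) = val f P A"
      unfolding val_def prev_y using True fin b iff by (subst sum.remove[of "P \<inter> A" b]) auto
    finally show ?thesis .
  next
    case False
    have "f p - f (prev_mark ?P p) = f p - f (prev_mark P p)" if p: "p \<in> P \<inter> A" for p
    proof -
      have "p \<noteq> b" using p iff False by blast
      then show ?thesis using p prev_other[of p] pos[of p] by simp
    qed
    then show ?thesis using False unfolding val_def by (intro sum.cong) auto
  qed
qed

text \<open>The value of a piece depends only on cumulative values at old marks. So whatever marks
  are added and however the profile varies in between, a value once known to the protocol stays
  valid.\<close>

lemma val_refine:
  assumes P: "marks P" and P': "marks P'" "P \<subseteq> P'" and A: "piece P A"
    and eq: "\<And>x. x \<in> P \<Longrightarrow> f' x = f x"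
  shows "val f' P' A = val f P A"
proof -
  have "val f' (P \<union> D) A = val f' P A" if "finite D" "D \<subseteq> {0..1}" for D
    using that
  proof (induction D rule: finite_induct)
    case (insert y D)
    have "marks (P \<union> D)" "piece (P \<union> D) A"
      using P insert piece_mono[OF A] by (auto simp: marks_def)
    then show ?case using val_insert_mark[of "P \<union> D" y A f'] insert by auto
  qed simp
  from this[of P'] have "val f' P' A = val f' P A"
    using P' by (simp add: marks_def Un_absorb1)
  also have "\<dots> = val f P A"
    unfolding val_def
  proof (rule sum.cong)
    fix p assume "p \<in> P \<inter> A"
    moreover from this have "prev_mark P p \<in> P"
      using prev_mark(1)[OF P] A by (auto simp: piece_def)
    ultimately show "f' p - f' (prev_mark P p) = f p - f (prev_mark P p)" using eq by simp
  qed simp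
  finally show ?thesis .
qed

lemma val_upto_prev:
  assumes P: "marks P" and p: "p \<in> P" "0 < p"
  shows "val f P (A \<inter> {0<..p}) = val f P (A \<inter> {0<..prev_mark P p}) +
    (if p \<in> A then f p - f (prev_mark P p) else 0)"
proof -
  let ?a = "prev_mark P p"
  have "P \<inter> (A \<inter> {0<..p}) = P \<inter> (A \<inter> {0<..?a}) \<union> ({p} \<inter> A)"
    using prev_mark[OF P p(2)] p by force
  then have "val f P (A \<inter> {0<..p}) =
      (\<Sum>q\<in>P \<inter> (A \<inter> {0<..?a}) \<union> ({p} \<inter> A). f q - f (prev_mark P q))"
    by (simp only: val_def)
  also have "\<dots> = val f P (A \<inter> {0<..?a}) + (\<Sum>q\<in>{p} \<inter> A. f q - f (prev_mark P q))"
    unfolding val_def using prev_mark(2)[OF P p(2)] P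
    by (intro sum.union_disjoint) (auto simp: marks_def)
  also have "(\<Sum>q\<in>{p} \<inter> A. f q - f (prev_mark P q)) = (if p \<in> A then f p - f ?a else 0)"
    by simp
  finally show ?thesis .
qed

text \<open>Cutting an initial part of value \<open>t\<close> off a scattered piece takes at most
  one cut query starting at 0. Either an existing mark is already right, or the cut falls inside a
  single cell of \<open>A\<close> and its cumulative level \<open>s\<close> is computed from values
  at marks. It has to work for every \<open>f'\<close> the adversary may switch to.\<close>

lemma cut_value:
  assumes P: "marks P" and f: "cdf f" and A: "piece P A" and t: "0 \<le> t" "t \<le> val f P A"
  shows "(\<exists>y\<in>P. val f P (A \<inter> {0<..y}) = t) \<or>
    (\<exists>s. 0 \<le> s \<and> s \<le> 1 \<and> (\<forall>y f'. 0 \<le> y \<and> y \<le> 1 \<and> cdf f' \<and> (\<forall>x\<in>P. f' x = f x) \<and> f' y = s \<longrightarrow>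
       val f' (insert y P) (A \<inter> {0<..y}) = t))"
proof -
  define g where "g p = val f P (A \<inter> {0<..p})" for p
  have fin: "finite P" "0 \<in> P" "1 \<in> P" "P \<subseteq> {0..1}" using P by (auto simp: marks_def)
  have "A \<inter> {0<..1} = A" using A by (auto simp: piece_def)
  then have g1: "g 1 = val f P A" by (simp add: g_def)
  \<comment> \<open>The first mark up to which \<open>A\<close> is worth at least \<open>t\<close>;
    the cut falls in the cell ending there.\<close>
  define p where "p = Min {p \<in> P. t \<le> g p}"
  have finp: "finite {p \<in> P. t \<le> g p}" "{p \<in> P. t \<le> g p} \<noteq> {}" using fin t g1 by auto
  have p: "p \<in> P" "t \<le> g p" using Min_in[OF finp] by (auto simp: p_def)
  have pmin: "p \<le> q" if "q \<in> P" "t \<le> g q" for q using finp that by (auto simp: p_def)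
  show ?thesis
  proof (cases "g p = t")
    case True
    then show ?thesis using p by (auto simp: g_def)
  next
    case False
    then have less: "t < g p" using p by simp
    have "p \<noteq> 0" using less t by (auto simp: g_def val_empty)
    moreover have "0 \<le> p" "p \<le> 1" using p fin by auto
    ultimately have p0: "0 < p" "p \<le> 1" by auto
    define a where "a = prev_mark P p"
    note a = prev_mark[OF P p0(1), folded a_def]
    have a1: "0 \<le> a" "a \<le> 1" using a fin p0 by auto
    have "g a < t" using pmin[of a] a by force
    have gp: "g p = g a + (if p \<in> A then f p - f a else 0)"
      unfolding g_def a_def by (rule val_upto_prev[OF P p(1) p0(1)])
    then have pA: "p \<in> A" using less \<open>g a < t\<close> by (auto split: if_splits)
    \<comment> \<open>Up to \<open>a\<close> the piece is worth \<open>g a\<close>; the missing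
      \<open>t - g a\<close> is measured off from \<open>a\<close> inside a cell that lies wholly in
      \<open>A\<close>.\<close>
    define s where "s = f a + (t - g a)"
    have s: "f a < s" "s < f p" using gp less \<open>g a < t\<close> pA by (auto simp: s_def)
    have "0 \<le> f a" "f p \<le> 1"
      using cdf_mono[OF f, of 0 a] cdf_mono[OF f, of p 1] f a1 p0 by (auto simp: cdf_def)
    then have "0 \<le> s" "s \<le> 1" using s by auto
    moreover have "val f' (insert y P) (A \<inter> {0<..y}) = t"
      if y: "0 \<le> y" "y \<le> 1" and f': "cdf f'" and eq: "\<forall>x\<in>P. f' x = f x" and fy: "f' y = s" for y f'
    proof -
      \<comment> \<open>\<open>s\<close> lies strictly between the values at \<open>a\<close> and
        \<open>p\<close>, which \<open>f'\<close> shares with \<open>f\<close>, so monotonicity puts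
        every admissible answer \<open>y\<close> inside the cell.\<close>
      have "f' a < f' y" "f' y < f' p" using s eq fy a p by auto
      then have ay: "a < y" "y < p"
        using cdf_mono[OF f', of y a] cdf_mono[OF f', of p y] a1 p0 y by force+
      let ?P = "insert y P"
      have P': "marks ?P" using P y by (auto simp: marks_def)
      have prev: "prev_mark ?P y = a"
      proof (rule prev_mark_eqI)
        show "q' \<le> a" if "q' \<in> insert y P" "q' < y" for q'
          using that a(3)[of q'] ay by auto
      qed (use fin a ay in auto)
      have same: "\<forall>q\<in>P. p \<le> q \<longleftrightarrow> y \<le> q"
        using a(3) ay by force
      then have yA: "y \<in> A" using pA p0 ay a1 by (intro pieceD[OF A pA]) auto
      have "val f' ?P (A \<inter> {0<..y}) = val f' ?P (A \<inter> {0<..a}) + (f' y - f' a)"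
        using val_upto_prev[OF P', of y f' A] prev yA ay a1 by simp
      also have "val f' ?P (A \<inter> {0<..a}) = g a"
        unfolding g_def using P P' A piece_upto a a1 eq
        by (intro val_refine) (auto intro: piece_Int piece_upto)
      finally show ?thesis using fy eq a by (simp add: s_def)
    qed
    ultimately show ?thesis by blast
  qed
qed

subsection \<open>Cutting against an adversary\<close>

definition state :: "nat \<Rightarrow> real set \<Rightarrow> (nat \<Rightarrow> real \<Rightarrow> real) \<Rightarrow> bool" where
  "state n P F \<longleftrightarrow> marks P \<and> (\<forall>i<n. cdf (F i))"

definition refines ::
  "nat \<Rightarrow> real set \<Rightarrow> (nat \<Rightarrow> real \<Rightarrow> real) \<Rightarrow> real set \<Rightarrow> (nat \<Rightarrow> real \<Rightarrow> real) \<Rightarrow> bool" where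
  "refines n P F P' F' \<longleftrightarrow> P \<subseteq> P' \<and> state n P' F' \<and> (\<forall>i<n. \<forall>x\<in>P. F' i x = F i x)"

text \<open>A game against an adversary who owns the profile \<^term>\<open>F\<close> of cumulative valuations and may
  change it as long as its values at the marks \<^term>\<open>P\<close>, which are all the protocol knows, stay fixed.
  The protocol can force \<^term>\<open>Q\<close> with \<^term>\<open>c\<close> cuts.\<close>

inductive reaches ::
  "nat \<Rightarrow> (real set \<Rightarrow> (nat \<Rightarrow> real \<Rightarrow> real) \<Rightarrow> bool) \<Rightarrow> nat \<Rightarrow> real set \<Rightarrow> (nat \<Rightarrow> real \<Rightarrow> real) \<Rightarrow> bool"
  for n Q where
  reaches_done: "Q P F \<Longrightarrow> reaches n Q c P F"
| reaches_step: "i < n \<Longrightarrow> 0 \<le> t \<Longrightarrow> t \<le> 1 \<Longrightarrow>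
    (\<And>y F'. 0 \<le> y \<Longrightarrow> y \<le> 1 \<Longrightarrow> refines n P F (insert y P) F' \<Longrightarrow> F' i y = t \<Longrightarrow>
       reaches n Q c (insert y P) F') \<Longrightarrow>
    reaches n Q (Suc c) P F"

lemma refines_refl: "state n P F \<Longrightarrow> refines n P F P F"
  by (simp add: refines_def)

lemma refines_trans: "refines n P F P' F' \<Longrightarrow> refines n P' F' P'' F'' \<Longrightarrow> refines n P F P'' F''"
  by (auto simp: refines_def)

lemma refines_state: "refines n P F P' F' \<Longrightarrow> state n P' F'"
  by (simp add: refines_def)

lemma refines_piece: "refines n P F P' F' \<Longrightarrow> piece P A \<Longrightarrow> piece P' A"
  by (auto simp: refines_def intro: piece_mono)

lemma refines_val:
  "refines n P F P' F' \<Longrightarrow> state n P F \<Longrightarrow> i < n \<Longrightarrow> piece P A \<Longrightarrow> val (F' i) P' A = val (F i) P A"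
  by (rule val_refine) (auto simp: refines_def state_def)

lemma reaches_weaken: "reaches n Q c P F \<Longrightarrow> reaches n Q (c + d) P F"
proof (induction rule: reaches.induct)
  case (reaches_step i t P F c)
  then show ?case by (auto intro: reaches.reaches_step)
qed (rule reaches_done)

text \<open>Sequential composition: the second strategy starts from whatever marks and profile the
  adversary has produced by the end of the first, and the cuts add up.\<close>

lemma reaches_bind:
  assumes "reaches n Q c P F" "state n P F"
    "\<And>P' F'. refines n P F P' F' \<Longrightarrow> Q P' F' \<Longrightarrow> reaches n Q' d P' F'"
  shows "reaches n Q' (c + d) P F"
  using assms
proof (induction rule: reaches.induct)
  case (reaches_done P F c)
  then have "reaches n Q' d P F" by (auto intro: refines_refl)
  then show ?case using reaches_weaken[of n Q' d P F c] by (simp add: add.commute)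
next
  case (reaches_step i t P F c)
  have "reaches n Q' (c + d) (insert y P) F'"
    if y: "0 \<le> y" "y \<le> 1" "refines n P F (insert y P) F'" "F' i y = t" for y F'
  proof (rule reaches_step.IH[OF y])
    show "state n (insert y P) F'" using y(3) by (rule refines_state)
    show "reaches n Q' d P' G" if "refines n (insert y P) F' P' G" "Q P' G" for P' G
      using reaches_step.prems(2) refines_trans[OF y(3)] that by blast
  qed
  then show ?case
    using reaches.reaches_step[OF reaches_step.hyps(1-3)] by simp
qed

lemma reaches_conseq:
  assumes "reaches n Q c P F" "state n P F"
    "\<And>P' F'. refines n P F P' F' \<Longrightarrow> Q P' F' \<Longrightarrow> Q' P' F'"
  shows "reaches n Q' c P F"
  using reaches_bind[OF assms(1,2), of Q' 0] assms(3) by (auto intro: reaches_done)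

lemma reaches_cut:
  assumes st: "state n P F" and i: "i < n" and A: "piece P A" and t: "0 \<le> t" "t \<le> val (F i) P A"
  shows "reaches n (\<lambda>P' F'. \<exists>B. piece P' B \<and> B \<subseteq> A \<and> val (F' i) P' B = t) 1 P F"
proof -
  have st': "marks P" "cdf (F i)" using st i by (auto simp: state_def)
  from cut_value[OF st' A t]
  show ?thesis
  proof (elim disjE bexE exE conjE)
    fix y assume "y \<in> P" "val (F i) P (A \<inter> {0<..y}) = t"
    moreover from this have "piece P (A \<inter> {0<..y})"
      using st' A by (intro piece_Int piece_upto) (auto simp: marks_def)
    ultimately show ?thesis by (intro reaches_done) blast
  next
    fix s assume s: "0 \<le> s" "s \<le> 1" and *: "\<forall>y f'. 0 \<le> y \<and> y \<le> 1 \<and> cdf f' \<and> (\<forall>x\<in>P. f' x = F i x) \<and>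
       f' y = s \<longrightarrow> val f' (insert y P) (A \<inter> {0<..y}) = t"
    have "reaches n (\<lambda>P' F'. \<exists>B. piece P' B \<and> B \<subseteq> A \<and> val (F' i) P' B = t) 0 (insert y P) F'"
      if y: "0 \<le> y" "y \<le> 1" "refines n P F (insert y P) F'" "F' i y = s" for y F'
    proof (rule reaches_done, intro exI conjI)
      show "val (F' i) (insert y P) (A \<inter> {0<..y}) = t"
        using * y i by (auto simp: refines_def state_def)
      show "piece (insert y P) (A \<inter> {0<..y})"
        using y A by (intro piece_Int piece_upto) (auto intro: piece_mono)
    qed auto
    then show ?thesis using reaches_step[OF i s] by simp
  qed
qed

text \<open>Parts are cut off one after the other; the last one is the remainder, which has the
  right value because the \<open>\<tau> k\<close> add up to the value of \<open>X\<close>.\<close>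

lemma reaches_divide:
  assumes "finite I" "I \<noteq> {}" "state n P F" "i < n" "piece P X"
    "\<And>k. k \<in> I \<Longrightarrow> 0 \<le> \<tau> k" "(\<Sum>k\<in>I. \<tau> k) = val (F i) P X"
  shows "reaches n (\<lambda>P' F'. \<exists>Y. (\<forall>k\<in>I. piece P' (Y k) \<and> val (F' i) P' (Y k) = \<tau> k) \<and>
    (\<Union>k\<in>I. Y k) = X \<and> disjoint_family_on Y I) (card I) P F"
  using assms
proof (induction I arbitrary: P F X rule: finite_ne_induct)
  case (singleton k)
  then show ?case
    by (intro reaches_done exI[of _ "\<lambda>_. X"]) (auto simp: disjoint_family_on_def)
next
  case (insert k I)
  let ?Q = "\<lambda>I X P' F'. \<exists>Y. (\<forall>k\<in>I. piece P' (Y k) \<and> val (F' i) P' (Y k) = \<tau> k) \<and>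
    (\<Union>k\<in>I. Y k) = X \<and> disjoint_family_on Y I"
  have "0 \<le> \<tau> k" "\<tau> k \<le> val (F i) P X"
    using insert.prems(4,5) insert.hyps(1,3) sum_nonneg[of I \<tau>] by force+
  then have "reaches n (\<lambda>P' F'. \<exists>B. piece P' B \<and> B \<subseteq> X \<and> val (F' i) P' B = \<tau> k) 1 P F"
    using insert.prems by (intro reaches_cut)
  then have "reaches n (?Q (insert k I) X) (1 + card I) P F"
  proof (rule reaches_bind[OF _ insert.prems(1)])
    fix P' F' assume ref: "refines n P F P' F'"
    assume "\<exists>B. piece P' B \<and> B \<subseteq> X \<and> val (F' i) P' B = \<tau> k"
    then obtain B where B: "piece P' B" "B \<subseteq> X" "val (F' i) P' B = \<tau> k" by auto
    have st': "state n P' F'" using ref by (rule refines_state)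
    have pX: "piece P' X" using refines_piece[OF ref] insert.prems by simp
    have "val (F' i) P' (X - B) = val (F i) P X - \<tau> k"
      using val_Diff[of P' B X "F' i"] B st' refines_val[OF ref] insert.prems by (simp add: state_def)
    then have sum: "(\<Sum>k\<in>I. \<tau> k) = val (F' i) P' (X - B)"
      using insert.prems(5) insert.hyps by simp
    have "reaches n (?Q I (X - B)) (card I) P' F'"
      using insert.prems st' pX B sum by (intro insert.IH) (auto intro: piece_Diff)
    then show "reaches n (?Q (insert k I) X) (card I) P' F'"
    proof (rule reaches_conseq[OF _ st'])
      fix P'' F'' assume ref': "refines n P' F' P'' F''" and "?Q I (X - B) P'' F''"
      then obtain Y where Y: "\<forall>k\<in>I. piece P'' (Y k) \<and> val (F'' i) P'' (Y k) = \<tau> k"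
        "(\<Union>k\<in>I. Y k) = X - B" "disjoint_family_on Y I" by blast
      let ?Y = "Y(k := B)"
      have "\<forall>j\<in>insert k I. piece P'' (?Y j) \<and> val (F'' i) P'' (?Y j) = \<tau> j"
        using Y(1) B refines_piece[OF ref'] refines_val[OF ref' st'] insert.prems(2) by auto
      moreover have "(\<Union>j\<in>insert k I. ?Y j) = B \<union> (\<Union>j\<in>I. Y j)"
        using insert.hyps(3) by auto
      moreover have "disjoint_family_on ?Y (insert k I)"
        using Y(2,3) insert.hyps(3) by (fastforce simp: disjoint_family_on_def)
      ultimately show "?Q (insert k I) X P'' F''"
        using Y(2) B(2) by (intro exI[of _ ?Y] conjI) auto
    qed
  qed
  then show ?case using insert.hyps by simp
qed

lemma reaches_trim:
  assumes "finite I" "state n P F"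
    "\<And>k. k \<in> I \<Longrightarrow> a k < n \<and> piece P (Y k) \<and> 0 \<le> \<tau> k \<and> \<tau> k \<le> val (F (a k)) P (Y k)"
  shows "reaches n (\<lambda>P' F'. \<exists>B. \<forall>k\<in>I. piece P' (B k) \<and> B k \<subseteq> Y k \<and>
    val (F' (a k)) P' (B k) = \<tau> k) (card I) P F"
  using assms
proof (induction I arbitrary: P F rule: finite_induct)
  case empty
  then show ?case by (auto intro: reaches_done)
next
  case (insert k I)
  let ?Q = "\<lambda>I P' F'. \<exists>B. \<forall>k\<in>I. piece P' (B k) \<and> B k \<subseteq> Y k \<and> val (F' (a k)) P' (B k) = \<tau> k"
  have "reaches n (\<lambda>P' F'. \<exists>B. piece P' B \<and> B \<subseteq> Y k \<and> val (F' (a k)) P' B = \<tau> k) 1 P F"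
    using insert.prems by (intro reaches_cut) auto
  then have "reaches n (?Q (insert k I)) (1 + card I) P F"
  proof (rule reaches_bind[OF _ insert.prems(1)])
    fix P' F' assume ref: "refines n P F P' F'"
    assume "\<exists>B. piece P' B \<and> B \<subseteq> Y k \<and> val (F' (a k)) P' B = \<tau> k"
    then obtain C where C: "piece P' C" "C \<subseteq> Y k" "val (F' (a k)) P' C = \<tau> k" by auto
    have st': "state n P' F'" using ref by (rule refines_state)
    have "reaches n (?Q I) (card I) P' F'"
      using insert.prems st' refines_piece[OF ref] refines_val[OF ref]
      by (intro insert.IH) auto
    then show "reaches n (?Q (insert k I)) (card I) P' F'"
    proof (rule reaches_conseq[OF _ st'])
      fix P'' F'' assume ref': "refines n P' F' P'' F''" and "?Q I P'' F''"
      then obtain B where B: "\<forall>k\<in>I. piece P'' (B k) \<and> B k \<subseteq> Y k \<and>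
        val (F'' (a k)) P'' (B k) = \<tau> k" by blast
      show "?Q (insert k I) P'' F''"
        using B C insert.prems(2)[of k] refines_piece[OF ref'] refines_val[OF ref' st'] insert.hyps
        by (intro exI[of _ "B(k := C)"]) auto
    qed
  qed
  then show ?case using insert.hyps by simp
qed

section \<open>From strategies in the game to Robertson-Webb protocols\<close>

lemma valuation_cdf:
  assumes "valuation v"
  shows "cdf (v 0)"
proof -
  have nn: "\<And>x y. 0 \<le> x \<and> x \<le> y \<and> y \<le> 1 \<Longrightarrow> 0 \<le> v x y"
    and add: "\<And>x y z. 0 \<le> x \<and> x \<le> y \<and> y \<le> z \<and> z \<le> 1 \<Longrightarrow> v x z = v x y + v y z"
    and atom: "\<And>x y l. 0 \<le> x \<and> x \<le> y \<and> y \<le> 1 \<and> 0 \<le> l \<and> l \<le> 1 \<Longrightarrow>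
        \<exists>y'. x \<le> y' \<and> y' \<le> 1 \<and> v x y' = l * v x y"
    and one: "v 0 1 = 1"
    using assms unfolding valuation_def by blast+
  have "v 0 0 = 0" using add[of 0 0 0] by simp
  moreover have "v 0 x \<le> v 0 y" if "0 \<le> x" "x \<le> y" "y \<le> 1" for x y
    using add[of 0 x y] nn[of x y] that by simp
  moreover have "\<exists>y. 0 \<le> y \<and> y \<le> 1 \<and> v 0 y = t" if "0 \<le> t" "t \<le> 1" for t
    using atom[of 0 1 t] one that by simp
  ultimately show ?thesis using one by (simp add: cdf_def)
qed

lemma succeeds_mono:
  "succeeds n E vs Pr c e \<Longrightarrow> c \<le> c' \<Longrightarrow> e \<le> e' \<Longrightarrow> succeeds n E vs Pr c' e'"
proof (induction Pr arbitrary: c e c' e')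
  case (CutQ i x t k)
  from CutQ.prems have "1 \<le> c'" "c - 1 \<le> c' - 1" by auto
  then show ?case using CutQ.prems(1,3) CutQ.IH[OF rangeI, of _ "c - 1" e "c' - 1" e'] by auto
next
  case (EvalQ i x y k)
  from EvalQ.prems have "1 \<le> e'" "e - 1 \<le> e' - 1" by auto
  then show ?case using EvalQ.prems(1,2) EvalQ.IH[OF rangeI, of _ c "e - 1" c' "e' - 1"] by auto
qed auto

text \<open>\<open>S\<close> collects the profiles compatible with the answers so far. A single
  protocol must serve all of them, since it cannot tell them apart.\<close>

definition solvable :: "nat \<Rightarrow> (nat \<Rightarrow> nat \<Rightarrow> bool) \<Rightarrow> (nat \<Rightarrow> real \<Rightarrow> real \<Rightarrow> real) set \<Rightarrow> real \<Rightarrow> real \<Rightarrow> bool"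
  where "solvable n E S c e \<longleftrightarrow> (\<exists>Pr. \<forall>vs\<in>S. succeeds n E vs Pr c e)"

lemma solvable_eval:
  assumes "i < n" "0 \<le> x" "x \<le> y" "y \<le> 1" "0 \<le> e"
    and "\<And>a. solvable n E {vs\<in>S. vs i x y = a} c e"
  shows "solvable n E S c (e + 1)"
proof -
  have "\<forall>a. \<exists>Pr. \<forall>vs\<in>{vs\<in>S. vs i x y = a}. succeeds n E vs Pr c e"
    using assms(6) unfolding solvable_def by blast
  from choice[OF this] obtain k where "\<forall>a. \<forall>vs\<in>{vs\<in>S. vs i x y = a}. succeeds n E vs (k a) c e"
    by blast
  then show ?thesis
    using assms(1-5) unfolding solvable_def by (intro exI[of _ "EvalQ i x y k"]) simp
qed

lemma solvable_eval_all:
  assumes "m \<le> n" "0 \<le> y" "y \<le> 1" "0 \<le> e"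
    and "\<And>f. solvable n E {vs\<in>S. \<forall>i<m. vs i 0 y = f i} c e"
  shows "solvable n E S c (e + real m)"
  using assms
proof (induction m arbitrary: S)
  case 0
  then show ?case by simp
next
  case (Suc m)
  have "solvable n E S c (e + real m + 1)"
  proof (rule solvable_eval[of m _ 0 y])
    fix a
    show "solvable n E {vs\<in>S. vs m 0 y = a} c (e + real m)"
    proof (rule Suc.IH)
      fix f :: "nat \<Rightarrow> real"
      have "{vs \<in> {vs\<in>S. vs m 0 y = a}. \<forall>i<m. vs i 0 y = f i} =
        {vs\<in>S. \<forall>i<Suc m. vs i 0 y = (f(m := a)) i}"
        by (auto simp: less_Suc_eq)
      then show "solvable n E {vs \<in> {vs\<in>S. vs m 0 y = a}. \<forall>i<m. vs i 0 y = f i} c e"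
        using Suc.prems(5)[of "f(m := a)"] by simp
    qed (use Suc.prems in auto)
  qed (use Suc.prems in auto)
  then show ?case by (simp add: ac_simps)
qed

lemma solvable_cut:
  assumes "i < n" "0 \<le> c" and "\<And>vs. vs \<in> S \<Longrightarrow> \<exists>y. 0 \<le> y \<and> y \<le> 1 \<and> vs i 0 y = t"
    and "\<And>y. 0 \<le> y \<Longrightarrow> y \<le> 1 \<Longrightarrow> solvable n E {vs\<in>S. vs i 0 y = t} c e"
  shows "solvable n E S (c + 1) e"
proof -
  have "\<forall>y. \<exists>Pr. 0 \<le> y \<and> y \<le> 1 \<longrightarrow> (\<forall>vs\<in>{vs\<in>S. vs i 0 y = t}. succeeds n E vs Pr c e)"
    using assms(4) unfolding solvable_def by blast
  from choice[OF this] obtain k where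
    "\<forall>y. 0 \<le> y \<and> y \<le> 1 \<longrightarrow> (\<forall>vs\<in>{vs\<in>S. vs i 0 y = t}. succeeds n E vs (k y) c e)"
    by blast
  then show ?thesis
    using assms(1-3) unfolding solvable_def by (intro exI[of _ "CutQ i 0 t k"]) simp
qed

definition consistent :: "nat \<Rightarrow> real set \<Rightarrow> (nat \<Rightarrow> real \<Rightarrow> real) \<Rightarrow> (nat \<Rightarrow> real \<Rightarrow> real \<Rightarrow> real) set" where
  "consistent n P F = {vs. (\<forall>i<n. valuation (vs i)) \<and> (\<forall>i<n. \<forall>x\<in>P. vs i 0 x = F i x)}"

text \<open>A move of the game becomes one query \<open>cut_i(0, t)\<close> followed by evaluations
  of \<open>[0, y]\<close> for all \<open>n\<close> agents, which reveal all cumulative values at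
  the new mark. Hence \<open>n\<close> evaluations per cut.\<close>

lemma reaches_solvable:
  assumes "reaches n Q c P F" "state n P F"
    and "\<And>P F. state n P F \<Longrightarrow> Q P F \<Longrightarrow>
      \<exists>p ow. \<forall>vs\<in>consistent n P F. valid_alloc n p ow \<and> locally_envy_free n E vs p ow"
  shows "solvable n E (consistent n P F) (real c) (real (n * c))"
  using assms(1,2)
proof (induction rule: reaches.induct)
  case (reaches_done P F c)
  then obtain p ow where
    "\<forall>vs\<in>consistent n P F. valid_alloc n p ow \<and> locally_envy_free n E vs p ow"
    using assms(3) by blast
  then show ?case unfolding solvable_def by (intro exI[of _ "Output p ow"]) auto
next
  case (reaches_step i t P F c)
  have "solvable n E (consistent n P F) (real c + 1) (real (n * c) + real n)"
  proof (rule solvable_cut[OF \<open>i < n\<close>])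
    fix vs assume "vs \<in> consistent n P F"
    then have "cdf (vs i 0)" using \<open>i < n\<close> valuation_cdf by (auto simp: consistent_def)
    then show "\<exists>y. 0 \<le> y \<and> y \<le> 1 \<and> vs i 0 y = t"
      using reaches_step.hyps(2,3) by (auto simp: cdf_def)
  next
    fix y :: real assume y: "0 \<le> y" "y \<le> 1"
    show "solvable n E {vs \<in> consistent n P F. vs i 0 y = t} (real c) (real (n * c) + real n)"
    proof (rule solvable_eval_all[OF order_refl y])
      fix f :: "nat \<Rightarrow> real"
      let ?S = "{vs \<in> {vs \<in> consistent n P F. vs i 0 y = t}. \<forall>i<n. vs i 0 y = f i}"
      show "solvable n E ?S (real c) (real (n * c))"
      \<comment> \<open>Answers that no profile can give are vacuous. Otherwise any profile
        \<open>ws\<close> giving them plays the adversary's new \<open>F'\<close>, and all other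
        compatible profiles agree with it at the marks.\<close>
      proof (cases "?S = {}")
        case True
        show ?thesis unfolding solvable_def True by simp
      next
        case False
        then obtain ws where ws: "ws \<in> ?S" by blast
        let ?F = "\<lambda>i. ws i 0"
        have ref: "refines n P F (insert y P) ?F"
          using ws y reaches_step.prems valuation_cdf
          by (auto simp: refines_def state_def marks_def consistent_def)
        have "?S \<subseteq> consistent n (insert y P) ?F"
          using ws by (auto simp: consistent_def)
        moreover have "solvable n E (consistent n (insert y P) ?F) (real c) (real (n * c))"
          using ws by (intro reaches_step.IH[OF y ref] refines_state[OF ref]) simp
        ultimately show ?thesis unfolding solvable_def by blast
      qed
    qed simp
  qed simp
  then show ?case by (simp add: algebra_simps)
qed

subsection \<open>Rounds\<close>

text \<open>\<open>Q v\<close> is the trimmed piece chosen by agent \<open>v\<close>,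
  \<open>Q r\<close> is the piece R, and \<open>b\<close> is the index of a heavily trimmed piece.
  The last inequality bounds what the round leaves behind by the advantage of \<open>r\<close> over
  whoever gets \<open>Q b\<close>.\<close>

definition good_round :: "nat \<Rightarrow> nat \<Rightarrow> (nat \<Rightarrow> nat) \<Rightarrow> real set \<Rightarrow> (nat \<Rightarrow> real \<Rightarrow> real) \<Rightarrow> real set \<Rightarrow>
    (nat \<Rightarrow> real set) \<Rightarrow> nat \<Rightarrow> bool" where
  "good_round n r head P F X Q b \<longleftrightarrow>
     piece P X \<and> (\<forall>v<n. piece P (Q v) \<and> Q v \<subseteq> X) \<and> disjoint_family_on Q {..<n} \<and> b < n \<and> b \<noteq> r \<and>
     (\<forall>v<n. v \<noteq> r \<longrightarrow> val (F (head v)) P (Q v) = val (F (head v)) P (Q r)) \<and>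
     (\<forall>v<n. val (F r) P (Q v) \<le> val (F r) P (Q r)) \<and>
     real n * val (F r) P (Q r) = val (F r) P X \<and>
     val (F r) P (X - (\<Union>v<n. Q v)) \<le> (real n - 1) * (val (F r) P (Q r) - val (F r) P (Q b))"

lemma good_round_refines:
  assumes "refines n P F P' F'" "state n P F" "r < n" "\<And>v. v < n \<Longrightarrow> v \<noteq> r \<Longrightarrow> head v < n"
    and gr: "good_round n r head P F X Q b"
  shows "good_round n r head P' F' X Q b"
proof -
  note V = refines_val[OF assms(1,2)]
  have p: "piece P X" "\<And>v. v < n \<Longrightarrow> piece P (Q v)" "b < n"
    using gr by (auto simp: good_round_def)
  then have p': "piece P (X - (\<Union>v<n. Q v))" by (intro piece_Diff piece_UN) auto
  show ?thesis
    using gr assms(3,4) p p' unfolding good_round_def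
    by (simp add: V refines_piece[OF assms(1)])
qed

text \<open>\<open>n\<close> cuts divide \<open>X\<close> into equal parts for \<open>r\<close>, and
  \<open>n - 1\<close> cuts trim the parts not kept by \<open>r\<close>. Trimming to the level of R
  is possible because everybody chose before \<open>r\<close>, by the taste of its head.\<close>

lemma reaches_round:
  assumes st: "state n P F" and n: "2 \<le> n" and r: "r < n"
    and head: "\<And>v. v < n \<Longrightarrow> v \<noteq> r \<Longrightarrow> head v < n" and X: "piece P X"
  shows "reaches n (\<lambda>P' F'. \<exists>Q b. good_round n r head P' F' X Q b) (2 * n) P F"
proof -
  have X0: "0 \<le> val (F r) P X" using st r X by (intro val_nonneg) (auto simp: state_def)
  let ?\<tau> = "\<lambda>_::nat. val (F r) P X / real n"
  have "reaches n (\<lambda>P' F'. \<exists>Y. (\<forall>k\<in>{..<n}. piece P' (Y k) \<and> val (F' r) P' (Y k) = ?\<tau> k) \<and>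
    (\<Union>k\<in>{..<n}. Y k) = X \<and> disjoint_family_on Y {..<n}) (card {..<n}) P F"
    using st n r X X0 by (intro reaches_divide) (auto simp: lessThan_empty_iff)
  then have "reaches n (\<lambda>P' F'. \<exists>Q b. good_round n r head P' F' X Q b) (card {..<n} + card {..<n}) P F"
  proof (rule reaches_bind[OF _ st])
    fix P' F' assume ref: "refines n P F P' F'"
      and "\<exists>Y. (\<forall>k\<in>{..<n}. piece P' (Y k) \<and> val (F' r) P' (Y k) = ?\<tau> k) \<and>
        (\<Union>k\<in>{..<n}. Y k) = X \<and> disjoint_family_on Y {..<n}"
    then obtain Y0 where Y0: "\<And>k. k < n \<Longrightarrow> piece P' (Y0 k)" "\<And>k. k < n \<Longrightarrow> val (F' r) P' (Y0 k) = ?\<tau> k"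
        "(\<Union>k\<in>{..<n}. Y0 k) = X" "disjoint_family_on Y0 {..<n}" by auto
    have st': "state n P' F'" using ref by (rule refines_state)
    then have mk': "marks P'" and cdf': "\<And>i. i < n \<Longrightarrow> cdf (F' i)" by (auto simp: state_def)
    have X': "piece P' X" "val (F' r) P' X = val (F r) P X"
      using refines_piece[OF ref X] refines_val[OF ref st r X] by auto
    have ins: "insert r ({..<n} - {r}) = {..<n}" using r by auto
    have "card {..<n} = Suc (card ({..<n} - {r}))" using r by simp
    from sequential_choice[OF _ _ this, of r "\<lambda>v s. val (F' (head v)) P' (Y0 s)"]
    obtain \<sigma> where \<sigma>: "bij_betw \<sigma> {..<n} {..<n}"
      "\<And>v. v < n \<Longrightarrow> v \<noteq> r \<Longrightarrow> val (F' (head v)) P' (Y0 (\<sigma> r)) \<le> val (F' (head v)) P' (Y0 (\<sigma> v))"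
      unfolding ins by auto
    define Y where "Y v = Y0 (\<sigma> v)" for v
    have \<sigma>n: "\<sigma> v < n" if "v < n" for v using bij_betwE[OF \<sigma>(1)] that by auto
    have Y: "\<And>k. k < n \<Longrightarrow> piece P' (Y k)" "\<And>k. k < n \<Longrightarrow> val (F' r) P' (Y k) = ?\<tau> k"
      using Y0(1,2) \<sigma>n by (auto simp: Y_def)
    have Yun: "(\<Union>k<n. Y k) = X"
    proof -
      have "(\<Union>k<n. Y k) = (\<Union>k\<in>\<sigma> ` {..<n}. Y0 k)" by (auto simp: Y_def)
      then show ?thesis using Y0(3) bij_betw_imp_surj_on[OF \<sigma>(1)] by simp
    qed
    have Ydis: "Y i \<inter> Y j = {}" if "i < n" "j < n" "i \<noteq> j" for i j
    proof -
      have "\<sigma> i \<noteq> \<sigma> j"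
        using bij_betw_imp_inj_on[OF \<sigma>(1)] that by (auto simp: inj_on_eq_iff)
      then show ?thesis
        using disjoint_family_onD[OF Y0(4), of "\<sigma> i" "\<sigma> j"] \<sigma>n that by (simp add: Y_def)
    qed
    let ?I = "{..<n} - {r}"
    have "reaches n (\<lambda>P'' F''. \<exists>B. \<forall>k\<in>?I. piece P'' (B k) \<and> B k \<subseteq> Y k \<and>
        val (F'' (head k)) P'' (B k) = val (F' (head k)) P' (Y r)) (card ?I) P' F'"
      using head st' Y r \<sigma>(2) val_nonneg[OF mk' cdf']
      by (intro reaches_trim) (auto simp: Y_def)
    then have "reaches n (\<lambda>P' F'. \<exists>Q b. good_round n r head P' F' X Q b) (card ?I) P' F'"
    proof (rule reaches_conseq[OF _ st'])
      fix P'' F'' assume ref': "refines n P' F' P'' F''"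
        and "\<exists>B. \<forall>k\<in>?I. piece P'' (B k) \<and> B k \<subseteq> Y k \<and>
          val (F'' (head k)) P'' (B k) = val (F' (head k)) P' (Y r)"
      then obtain B where B: "\<forall>k\<in>?I. piece P'' (B k) \<and> B k \<subseteq> Y k \<and>
          val (F'' (head k)) P'' (B k) = val (F' (head k)) P' (Y r)" by blast
      have st'': "state n P'' F''" using ref' by (rule refines_state)
      then have mk: "marks P''" and cdf: "\<And>i. i < n \<Longrightarrow> cdf (F'' i)" by (auto simp: state_def)
      define Q where "Q = B(r := Y r)"
      have Y'': "\<And>k. k < n \<Longrightarrow> piece P'' (Y k)" using refines_piece[OF ref'] Y by auto
      have VY: "\<And>i k. i < n \<Longrightarrow> k < n \<Longrightarrow> val (F'' i) P'' (Y k) = val (F' i) P' (Y k)"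
        using refines_val[OF ref' st'] Y by auto
      have Q: "\<And>v. v < n \<Longrightarrow> piece P'' (Q v) \<and> Q v \<subseteq> Y v" using B Y'' by (auto simp: Q_def)
      have Qr: "Q r = Y r" by (simp add: Q_def)
      have VX: "val (F'' r) P'' X = val (F r) P X" using refines_val[OF ref' st' r X'(1)] X' by simp
      have Yr: "val (F'' r) P'' (Y v) = val (F r) P X / n" if "v < n" for v
        using VY Y(2) r that by simp
      have Qle: "val (F'' r) P'' (Q v) \<le> val (F'' r) P'' (Q r)" if "v < n" for v
        using val_mono[OF mk cdf, of r "Y v" "Q v"] Y'' Q that r Yr Qr by simp
      have QX: "\<And>v. v < n \<Longrightarrow> Q v \<subseteq> X" using Q Yun by blast
      have Qdis: "Q i \<inter> Q j = {}" if "i < n" "j < n" "i \<noteq> j" for i j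
        using Q Ydis[OF that] that by blast
      \<comment> \<open>\<open>g v\<close> is what trimming took off slot \<open>v\<close> in the
        eyes of \<open>r\<close>. The remaining cake consists of these trimmings, and the largest of
        them is at least their average over the \<open>n - 1\<close> slots.\<close>
      define g where "g v = val (F'' r) P'' (Q r) - val (F'' r) P'' (Q v)" for v
      have "(\<Union>v<n. Q v) \<subseteq> X" using QX by auto
      then have "val (F'' r) P'' (X - (\<Union>v<n. Q v)) = val (F r) P X - val (F'' r) P'' (\<Union>v<n. Q v)"
        using val_Diff[OF mk] VX by simp
      also have "val (F'' r) P'' (\<Union>v<n. Q v) = (\<Sum>v<n. val (F'' r) P'' (Q v))"
        using Qdis by (intro val_UN[OF mk]) auto
      also have "val (F r) P X - \<dots> = (\<Sum>v<n. g v)"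
        using n Yr[OF r] Qr by (simp add: g_def sum_subtractf)
      also have "\<dots> = (\<Sum>v\<in>?I. g v)"
        using r by (simp add: sum.remove[of "{..<n}" r] g_def)
      finally have rest: "val (F'' r) P'' (X - (\<Union>v<n. Q v)) = (\<Sum>v\<in>?I. g v)" .
      have "(if r = 0 then 1 else 0) \<in> ?I" using n r by auto
      then have "finite ?I" "?I \<noteq> {}" by blast+
      then obtain b where b: "b \<in> ?I" "\<And>v. v \<in> ?I \<Longrightarrow> g v \<le> g b"
        by (rule obtain_maximizer[of ?I g]) auto
      have "(\<Sum>v\<in>?I. g v) \<le> real (card ?I) * g b" using b by (intro sum_bounded_above) auto
      also have "real (card ?I) = real n - 1" using r n by (simp add: of_nat_diff)
      finally have "val (F'' r) P'' (X - (\<Union>v<n. Q v)) \<le> (real n - 1) * g b" using rest by simp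
      moreover have "val (F'' (head v)) P'' (Q v) = val (F'' (head v)) P'' (Q r)" if "v < n" "v \<noteq> r" for v
        using B that VY head r Qr by (auto simp: Q_def)
      moreover have "real n * val (F'' r) P'' (Q r) = val (F'' r) P'' X"
        using Yr[OF r] Qr VX n by simp
      moreover have "disjoint_family_on Q {..<n}" using Qdis by (auto simp: disjoint_family_on_def)
      ultimately have "good_round n r head P'' F'' X Q b"
        using b Q QX Qle refines_piece[OF ref' X'(1)] by (auto simp: good_round_def g_def)
      then show "\<exists>Q b. good_round n r head P'' F'' X Q b" by blast
    qed
    \<comment> \<open>One spare cut rounds the cost of trimming up from \<open>n - 1\<close> to
      \<open>n\<close>.\<close>
    then have "reaches n (\<lambda>P' F'. \<exists>Q b. good_round n r head P' F' X Q b) (card ?I + 1) P' F'"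
      by (rule reaches_weaken)
    then show "reaches n (\<lambda>P' F'. \<exists>Q b. good_round n r head P' F' X Q b) (card {..<n}) P' F'"
      using r by simp
  qed
  then show ?thesis by (simp add: mult_2)
qed

section \<open>Iterated rounds and the decay of the remaining cake\<close>

definition leftover :: "nat \<Rightarrow> (nat \<Rightarrow> nat \<Rightarrow> real set) \<Rightarrow> nat \<Rightarrow> real set" where
  "leftover n Q t = {0<..1} - (\<Union>s<t. \<Union>v<n. Q s v)"

lemma leftover_Suc: "leftover n Q (Suc t) = leftover n Q t - (\<Union>v<n. Q t v)"
  by (auto simp: leftover_def less_Suc_eq)

lemma leftover_cong: "(\<And>s. s < t \<Longrightarrow> Q s = Q' s) \<Longrightarrow> leftover n Q t = leftover n Q' t"
  by (simp add: leftover_def)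

lemma piece_leftover:
  "(\<And>s v. s < t \<Longrightarrow> v < n \<Longrightarrow> piece P (Q s v)) \<Longrightarrow> piece P (leftover n Q t)"
  unfolding leftover_def by (intro piece_Diff piece_whole piece_UN) auto

definition good_rounds :: "nat \<Rightarrow> nat \<Rightarrow> (nat \<Rightarrow> nat) \<Rightarrow> real set \<Rightarrow> (nat \<Rightarrow> real \<Rightarrow> real) \<Rightarrow> nat \<Rightarrow>
    (nat \<Rightarrow> nat \<Rightarrow> real set) \<Rightarrow> (nat \<Rightarrow> nat) \<Rightarrow> bool" where
  "good_rounds n r head P F M Q b \<longleftrightarrow>
     (\<forall>t<M. good_round n r head P F (leftover n Q t) (Q t) (b t))"

lemma good_rounds_piece:
  "good_rounds n r head P F M Q b \<Longrightarrow> t < M \<Longrightarrow> v < n \<Longrightarrow> piece P (Q t v)"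
  by (simp add: good_rounds_def good_round_def)

lemma reaches_rounds:
  assumes st: "state n P F" and n: "2 \<le> n" and r: "r < n"
    and head: "\<And>v. v < n \<Longrightarrow> v \<noteq> r \<Longrightarrow> head v < n"
  shows "reaches n (\<lambda>P' F'. \<exists>Q b. good_rounds n r head P' F' M Q b) (M * (2 * n)) P F"
proof (induction M)
  case 0
  show ?case by (intro reaches_done) (simp add: good_rounds_def)
next
  case (Suc M)
  have "reaches n (\<lambda>P' F'. \<exists>Q b. good_rounds n r head P' F' (Suc M) Q b) (M * (2 * n) + 2 * n) P F"
  proof (rule reaches_bind[OF Suc st])
    fix P' F' assume ref: "refines n P F P' F'" and "\<exists>Q b. good_rounds n r head P' F' M Q b"
    then obtain Q b where Qb: "good_rounds n r head P' F' M Q b" by blast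
    have st': "state n P' F'" using ref by (rule refines_state)
    have "piece P' (leftover n Q M)" using good_rounds_piece[OF Qb] by (rule piece_leftover)
    from reaches_round[OF st' n r head this]
    show "reaches n (\<lambda>P' F'. \<exists>Q b. good_rounds n r head P' F' (Suc M) Q b) (2 * n) P' F'"
    proof (rule reaches_conseq[OF _ st'])
      fix P'' F'' assume ref': "refines n P' F' P'' F''"
        and "\<exists>Q' b'. good_round n r head P'' F'' (leftover n Q M) Q' b'"
      then obtain Q' b' where Q': "good_round n r head P'' F'' (leftover n Q M) Q' b'" by blast
      have eq: "leftover n (Q(M := Q')) t = leftover n Q t" if "t \<le> M" for t
        using that by (intro leftover_cong) auto
      have "good_round n r head P'' F'' (leftover n Q t) (Q t) (b t)" if "t < M" for t
        using good_round_refines[OF ref' st' r head] Qb that by (auto simp: good_rounds_def)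
      then have "good_rounds n r head P'' F'' (Suc M) (Q(M := Q')) (b(M := b'))"
        using Q' eq by (auto simp: good_rounds_def less_Suc_eq)
      then show "\<exists>Q b. good_rounds n r head P'' F'' (Suc M) Q b" by blast
    qed
  qed
  then show ?case by (simp add: ac_simps)
qed

lemma good_rounds_refines:
  assumes "refines n P F P' F'" "state n P F" "r < n" "\<And>v. v < n \<Longrightarrow> v \<noteq> r \<Longrightarrow> head v < n"
    and "good_rounds n r head P F M Q b"
  shows "good_rounds n r head P' F' M Q b"
  using good_round_refines[OF assms(1-4)] assms(5) by (auto simp: good_rounds_def)

text \<open>For \<open>r\<close> the untrimmed \<open>Q s r\<close> is worth exactly
  \<open>1 / n\<close> of the cake of round \<open>s\<close>, so at least that share goes. The start
  \<open>t\<close> is arbitrary because the decay is counted from the round in which the head gets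
  \<open>b\<close>.\<close>

lemma leftover_decay:
  assumes st: "state n P F" and n: "2 \<le> n" and r: "r < n" and gr: "good_rounds n r head P F M Q b"
    and tk: "t + k \<le> M"
  shows "val (F r) P (leftover n Q (t + k)) \<le> (1 - 1 / real n) ^ k * val (F r) P (leftover n Q t)"
  using tk
proof (induction k)
  case (Suc k)
  let ?V = "val (F r) P" and ?s = "t + k"
  have mk: "marks P" "cdf (F r)" using st r by (auto simp: state_def)
  have s: "?s < M" using Suc by simp
  then have g: "good_round n r head P F (leftover n Q ?s) (Q ?s) (b ?s)"
    using gr by (simp add: good_rounds_def)
  have pc: "piece P (leftover n Q ?s)" "piece P (Q ?s r)" "Q ?s r \<subseteq> leftover n Q ?s"
    using g r by (auto simp: good_round_def)
  have "?V (leftover n Q (t + Suc k)) \<le> ?V (leftover n Q ?s - Q ?s r)"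
    using s r good_rounds_piece[OF gr] pc
    by (intro val_mono mk piece_Diff piece_leftover) (auto simp: leftover_Suc)
  also have "\<dots> = ?V (leftover n Q ?s) - ?V (Q ?s r)" by (rule val_Diff[OF mk(1) pc(3)])
  also have "?V (Q ?s r) = ?V (leftover n Q ?s) / real n"
    using g n by (simp add: good_round_def field_simps)
  also have "?V (leftover n Q ?s) - ?V (leftover n Q ?s) / real n =
      (1 - 1 / real n) * ?V (leftover n Q ?s)" by (simp add: algebra_simps)
  also have "\<dots> \<le> (1 - 1 / real n) * ((1 - 1 / real n) ^ k * ?V (leftover n Q t))"
    using Suc n by (intro mult_left_mono) (auto simp: divide_le_eq)
  finally show ?case by (simp add: ac_simps)
qed simp

subsection \<open>Trees of depth two and the final allocation\<close>

text \<open>The edges from the \<open>n - 1\<close> non-root vertices to their parents are distinct,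
  so in a tree they are all the edges; in particular no edge joins two leaves.\<close>

lemma tree_heads:
  assumes "tree_depth_le2 n E"
  shows "\<exists>r<n. \<exists>head. (\<forall>v<n. v \<noteq> r \<longrightarrow> head v < n \<and> head v \<noteq> r \<and> head (head v) = head v) \<and>
    (\<forall>i j. E i j \<longrightarrow> (\<exists>v<n. v \<noteq> r \<and>
       (i = r \<and> j = head v \<or> i = head v \<and> j = r \<or> i = v \<and> j = head v \<or> i = head v \<and> j = v)))"
proof -
  from assms obtain r where graph: "graph_on n E" and cardE: "card {(i, j). i < j \<and> E i j} = n - 1"
    and r: "r < n" and cover: "\<forall>v<n. v = r \<or> E r v \<or> (\<exists>u. E r u \<and> E u v)"
    by (auto simp: tree_depth_le2_def is_tree_def)
  have E: "i < n" "j < n" "i \<noteq> j" "E j i" if "E i j" for i j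
    using graph that unfolding graph_on_def by blast+
  \<comment> \<open>\<open>SOME\<close> picks one of possibly several candidates; the edge count
    below excludes the others.\<close>
  define par where "par v = (if E r v then r else SOME u. E r u \<and> E u v)" for v
  define head where "head v = (if E r v then v else par v)" for v
  have par: "E r (par v)" "E (par v) v" if "v < n" "v \<noteq> r" "\<not> E r v" for v
  proof -
    have "\<exists>u. E r u \<and> E u v" using cover that by blast
    then have "E r (par v) \<and> E (par v) v"
      using someI_ex[of "\<lambda>u. E r u \<and> E u v"] that(3) by (simp add: par_def)
    then show "E r (par v)" "E (par v) v" by auto
  qed
  have par_edge: "E (par v) v" if "v < n" "v \<noteq> r" for v
    using par[OF that] by (cases "E r v") (auto simp: par_def)
  have E_head: "E r (head v)" if "v < n" "v \<noteq> r" for v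
    using par[OF that] by (auto simp: head_def)
  then have head: "head v < n \<and> head v \<noteq> r \<and> head (head v) = head v" if "v < n" "v \<noteq> r" for v
    using E(2,3) that by (metis head_def)
  let ?V = "{..<n} - {r}" and ?E = "{(i, j). i < j \<and> E i j}"
  define edge where "edge v = (min v (par v), max v (par v))" for v
  have edge_eq: "{v, par v} = {w, par w}" if "edge v = edge w" for v w
    using that by (auto simp: edge_def min_def max_def split: if_splits)
  \<comment> \<open>Two vertices with the same edge would be parents of each other. Then the parent
    of \<open>v\<close> is a neighbour of \<open>r\<close>, whose own parent is \<open>r\<close> and
    not \<open>v\<close>.\<close>
  have "inj_on edge ?V"
  proof (rule inj_onI, rule ccontr)
    fix v w assume vw: "v \<in> ?V" "w \<in> ?V" "edge v = edge w" "v \<noteq> w"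
    then have eq: "par v = w" "par w = v" using edge_eq[of v w] by (auto simp: doubleton_eq_iff)
    then have "\<not> E r v" using vw(2) by (auto simp: par_def)
    then have "E r w" using par(1)[of v] vw eq by auto
    then show False using eq vw by (auto simp: par_def)
  qed
  then have "card (edge ` ?V) = n - 1" using r by (simp add: card_image)
  moreover have "edge ` ?V \<subseteq> ?E"
    using par_edge E(3,4) by (auto simp: edge_def min_def max_def less_le)
  moreover have "finite ?E"
    by (rule finite_subset[of _ "{..<n} \<times> {..<n}"]) (use E in auto)
  ultimately have img: "edge ` ?V = ?E" using cardE by (metis card_subset_eq)
  have edges: "\<exists>v<n. v \<noteq> r \<and> {i, j} = {v, par v}" if "E i j" for i j
  proof -
    have "(min i j, max i j) \<in> ?E"
      using E(3,4)[OF that] that by (auto simp: min_def max_def)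
    then obtain v where "v \<in> ?V" "(min i j, max i j) = edge v" using img by blast
    then show ?thesis by (intro exI[of _ v]) (auto simp: edge_def min_def max_def split: if_splits)
  qed
  have "\<exists>v<n. v \<noteq> r \<and>
       (i = r \<and> j = head v \<or> i = head v \<and> j = r \<or> i = v \<and> j = head v \<or> i = head v \<and> j = v)"
    if e: "E i j" for i j
  proof -
    obtain v where v: "v < n" "v \<noteq> r" "{i, j} = {v, par v}" using edges[OF e] by blast
    show ?thesis
    proof (cases "E r v")
      case True
      then have "{i, j} = {head v, r}" using v by (simp add: head_def par_def)
      then show ?thesis using v(1,2) by (auto simp: doubleton_eq_iff)
    next
      case False
      then have "{i, j} = {v, head v}" using v by (simp add: head_def)
      then show ?thesis using v(1,2) by (auto simp: doubleton_eq_iff)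
    qed
  qed
  then show ?thesis using r head by blast
qed

text \<open>The output is read off from the marks and the pieces alone: the segments are the cells,
  each owned by the agent whose piece contains its right end. So one output serves all profiles
  compatible with the values at the marks.\<close>

lemma pieces_output:
  assumes st: "state n P F" and A: "\<And>a. a < n \<Longrightarrow> piece P (A a)"
    and dis: "disjoint_family_on A {..<n}" and cov: "(\<Union>a<n. A a) = {0<..1}"
    and E: "\<And>i j. E i j \<Longrightarrow> i < n \<and> j < n \<and> val (F i) P (A j) \<le> val (F i) P (A i)"
  shows "\<exists>p ow. \<forall>vs\<in>consistent n P F. valid_alloc n p ow \<and> locally_envy_free n E vs p ow"
proof -
  have mk: "marks P" using st by (simp add: state_def)
  then have P: "finite P" "0 \<in> P" "1 \<in> P" "P \<subseteq> {0..1}" by (auto simp: marks_def)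
  define p where "p = sorted_list_of_set P"
  define m where "m = length p - 1"
  have p: "set p = P" "sorted p" "distinct p" using P by (auto simp: p_def)
  have "p \<noteq> []" using p P by auto
  then have len: "length p = Suc m" by (simp add: m_def)
  have mono: "p ! i < p ! j" if "i < j" "j \<le> m" for i j
    using that p(2,3) len by (metis le_imp_less_Suc less_le nth_eq_iff_index_eq order.strict_trans sorted_nth_mono)
  have pP: "p ! i \<in> P" if "i \<le> m" for i using that len p(1) nth_mem[of i p] by simp
  have exI': "\<exists>i\<le>m. x = p ! i" if "x \<in> P" for x
    using that p(1) len by (metis in_set_conv_nth less_Suc_eq_le)
  have p0: "p ! 0 = 0"
  proof -
    obtain i where i: "i \<le> m" "0 = p ! i" using exI' P(2) by blast
    show ?thesis using mono[of 0 i] i pP[of 0] P(4) by (cases "i = 0") auto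
  qed
  have pm: "p ! m = 1"
  proof -
    obtain i where i: "i \<le> m" "1 = p ! i" using exI' P(3) by blast
    show ?thesis using mono[of i m] i pP[of m] P(4) by (cases "i = m") auto
  qed
  have prev: "prev_mark P (p ! Suc k) = p ! k" if "k < m" for k
  proof (rule prev_mark_eqI)
    fix q assume q: "q \<in> P" "q < p ! Suc k"
    then obtain i where i: "i \<le> m" "q = p ! i" using exI' by blast
    then have "\<not> Suc k < i" "i \<noteq> Suc k" using q mono[of "Suc k" i] by auto
    then have "i \<le> k" by simp
    then show "q \<le> p ! k" using i mono[of i k] that by (cases "i = k") auto
  qed (use that P pP mono in auto)
  have bij: "bij_betw (\<lambda>k. p ! Suc k) {..<m} (P - {0})"
  proof (rule bij_betwI')
    fix i j assume "i \<in> {..<m}" "j \<in> {..<m}"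
    then show "(p ! Suc i = p ! Suc j) = (i = j)" using p(3) len by (simp add: nth_eq_iff_index_eq)
  next
    fix i assume "i \<in> {..<m}"
    then show "p ! Suc i \<in> P - {0}" using pP mono[of 0 "Suc i"] p0 by auto
  next
    fix x assume x: "x \<in> P - {0}"
    then obtain i where "i \<le> m" "x = p ! i" using exI' by blast
    then show "\<exists>k\<in>{..<m}. x = p ! Suc k" using x p0 by (cases i) auto
  qed
  define ow where "ow = map (\<lambda>k. SOME a. a < n \<and> p ! Suc k \<in> A a) [0..<m]"
  have ow_len: "length ow = m" by (simp add: ow_def)
  have ow: "ow ! k < n" "p ! Suc k \<in> A (ow ! k)" if "k < m" for k
  proof -
    have "p ! Suc k \<in> P - {0}" using bij_betwE[OF bij] that by auto
    then have "p ! Suc k \<in> (\<Union>a<n. A a)" using cov P(4) by auto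
    then have "\<exists>a. a < n \<and> p ! Suc k \<in> A a" by blast
    from someI_ex[OF this] show "ow ! k < n" "p ! Suc k \<in> A (ow ! k)"
      using that by (simp_all add: ow_def)
  qed
  have ow_iff: "ow ! k = j \<longleftrightarrow> p ! Suc k \<in> A j" if "k < m" "j < n" for k j
    using ow[OF that(1)] disjoint_family_onD[OF dis, of "ow ! k" j] that by auto
  have alloc: "valid_alloc n p ow"
    using len ow_len p0 pm p(2) ow(1) \<open>p \<noteq> []\<close> by (simp add: valid_alloc_def last_conv_nth)
  have pv: "piece_val v p ow j = val (v 0) P (A j)" if v: "valuation v" and j: "j < n" for v j
  proof -
    let ?g = "\<lambda>x. if x \<in> A j then v 0 x - v 0 (prev_mark P x) else 0"
    have "piece_val v p ow j = (\<Sum>k<m. ?g (p ! Suc k))"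
      unfolding piece_val_def ow_len
    proof (rule sum.cong)
      fix k assume "k \<in> {..<m}"
      then have k: "k < m" by simp
      have "0 \<le> p ! k" "p ! k \<le> p ! Suc k" "p ! Suc k \<le> 1"
        using pP[of k] pP[of "Suc k"] P(4) k mono[of k "Suc k"] by auto
      then have "v 0 (p ! Suc k) = v 0 (p ! k) + v (p ! k) (p ! Suc k)"
        using v unfolding valuation_def by blast
      then show "(if ow ! k = j then v (p ! k) (p ! Suc k) else 0) = ?g (p ! Suc k)"
        using ow_iff[OF k j] prev[OF k] by simp
    qed simp
    \<comment> \<open>Segment \<open>k\<close> is identified with its right end
      \<open>p ! Suc k\<close>; 0 is the only mark that is no right end.\<close>
    also have "\<dots> = (\<Sum>x\<in>P - {0}. ?g x)" by (rule sum.reindex_bij_betw[OF bij])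
    also have "\<dots> = (\<Sum>x\<in>P \<inter> A j. ?g x)"
      using piece_subset[OF A[OF j]] P by (intro sum.mono_neutral_right) auto
    also have "\<dots> = val (v 0) P (A j)" unfolding val_def by (intro sum.cong) auto
    finally show ?thesis .
  qed
  have "locally_envy_free n E vs p ow" if vs: "vs \<in> consistent n P F" for vs
    unfolding locally_envy_free_def
  proof (intro allI impI)
    fix i j assume "E i j"
    then have ij: "i < n" "j < n" "val (F i) P (A j) \<le> val (F i) P (A i)" using E by auto
    have "piece_val (vs i) p ow a = val (F i) P (A a)" if "a < n" for a
    proof -
      have "piece_val (vs i) p ow a = val (vs i 0) P (A a)"
        using vs ij that by (intro pv) (auto simp: consistent_def)
      also have "\<dots> = val (F i) P (A a)"
        using vs ij that by (intro val_refine mk A) (auto simp: consistent_def)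
      finally show ?thesis .
    qed
    then show "piece_val (vs i) p ow i \<ge> piece_val (vs i) p ow j" using ij by simp
  qed
  then show ?thesis using alloc by blast
qed

section \<open>Redistributing the rounds and assembling the pieces\<close>

lemma pigeonhole_fibres:
  assumes "finite S" "finite T" "card T < card S"
  shows "\<exists>h\<in>f ` S \<union> g ` T. card {y\<in>T. g y = h} < card {x\<in>S. f x = h}"
proof (rule ccontr)
  let ?H = "f ` S \<union> g ` T"
  \<comment> \<open>The fibre sizes add up to \<open>card S\<close> and \<open>card T\<close>, so
    they cannot all be ordered the other way.\<close>
  assume "\<not> ?thesis"
  then have "(\<Sum>h\<in>?H. card {x\<in>S. f x = h}) \<le> (\<Sum>h\<in>?H. card {y\<in>T. g y = h})"
    by (intro sum_mono) force
  moreover have "(\<Sum>h\<in>?H. card {x\<in>S. f x = h}) = card S"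
    using sum.group[of S ?H f "\<lambda>_. 1::nat"] assms by simp
  moreover have "(\<Sum>h\<in>?H. card {y\<in>T. g y = h}) = card T"
    using sum.group[of T ?H g "\<lambda>_. 1::nat"] assms by simp
  ultimately show False using assms by simp
qed

lemma good_rounds_slots_disjoint:
  assumes gr: "good_rounds n r head P F M Q b" and "s < M" "t < M" "v < n" "w < n" "(s, v) \<noteq> (t, w)"
  shows "Q s v \<inter> Q t w = {}"
proof -
  have diff: "Q s v \<inter> Q t w = {}" if "s < t" "t < M" "v < n" "w < n" for s t v w
  proof -
    have "Q t w \<subseteq> leftover n Q t" using gr that by (simp add: good_rounds_def good_round_def)
    then show ?thesis using that by (auto simp: leftover_def)
  qed
  have "Q t v \<inter> Q t w = {}" if "v \<noteq> w"
    using gr assms that by (auto simp: good_rounds_def good_round_def disjoint_family_on_def)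
  then show ?thesis
    using diff[of s t v w] diff[of t s w v] assms by (cases s t rule: linorder_cases) auto
qed

text \<open>\<open>u v t s\<close> stands for the value to agent \<open>v\<close> of slot
  \<open>s\<close> in round \<open>t\<close>. The group of \<open>h\<close> is treated by
  \<open>star_exchange\<close>, every other group by sequential choice in each round, and the
  permutations of the groups are glued together.\<close>

lemma good_rounds_exchange:
  assumes n: "r < n" and head: "\<And>v. v < n \<Longrightarrow> v \<noteq> r \<Longrightarrow> head v < n \<and> head v \<noteq> r \<and> head (head v) = head v"
    and b: "\<And>t. b t < n \<and> b t \<noteq> r" and nM: "n \<le> M"
    and cnt: "card {v \<in> {..<n} - {r}. head v = h} < card {t \<in> {..<n}. head (b t) = h}"
    and h: "h < n" "h \<noteq> r" "head h = h"
  fixes u :: "nat \<Rightarrow> nat \<Rightarrow> nat \<Rightarrow> real"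
  shows "\<exists>\<pi>. (\<forall>t. bij_betw (\<pi> t) {..<n} {..<n} \<and> \<pi> t r = r \<and>
        (\<forall>v<n. v \<noteq> r \<longrightarrow> \<pi> t v \<noteq> r \<and> head (\<pi> t v) = head v)) \<and>
     (\<forall>v<n. v \<noteq> r \<longrightarrow> (\<Sum>t<M. u v t (\<pi> t (head v))) \<le> (\<Sum>t<M. u v t (\<pi> t v))) \<and>
     (\<exists>t<n. \<pi> t h = b t)"
proof -
  define G where "G k = {v \<in> {..<n} - {r}. head v = k}" for k
  have perms: "\<exists>p. (\<forall>t. bij_betw (p t) (G k) (G k)) \<and>
      (\<forall>l\<in>G k - {k}. (\<Sum>t<M. u l t (p t k)) \<le> (\<Sum>t<M. u l t (p t l))) \<and> (k = h \<longrightarrow> (\<exists>t<n. p t h = b t))"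
    if k: "k < n" "k \<noteq> r" "head k = k" for k
  proof -
    have fin: "finite (G k)" and mem: "k \<in> G k" using k by (auto simp: G_def)
    then have ins: "insert k (G k - {k}) = G k" and card: "card (G k) = Suc (card (G k - {k}))"
      by (auto simp del: card_Diff_insert simp add: card.remove)
    show ?thesis
    proof (cases "k = h")
      case True
      let ?T = "{t \<in> {..<n}. head (b t) = h}"
      have "card (G k - {k}) < card ?T" using cnt card True by (simp add: G_def)
      moreover have "?T \<subseteq> {..<M}" using nM by auto
      moreover have "b t \<in> G k" if "t \<in> ?T" for t using that b[of t] True by (simp add: G_def)
      ultimately show ?thesis
        using star_exchange[of "G k - {k}" k "{..<M}" ?T "G k" b u] fin card True ins by auto
    next
      case False
      have "\<exists>\<sigma>. bij_betw \<sigma> (G k) (G k) \<and> (\<forall>l\<in>G k - {k}. u l t (\<sigma> k) \<le> u l t (\<sigma> l))" for t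
        using sequential_choice[of "G k - {k}" k "G k" "\<lambda>l. u l t"] fin card ins by simp
      then obtain p where "\<And>t. bij_betw (p t) (G k) (G k)"
        "\<And>t. \<forall>l\<in>G k - {k}. u l t (p t k) \<le> u l t (p t l)" by metis
      then show ?thesis using False by (intro exI[of _ p]) (auto intro: sum_mono)
    qed
  qed
  define p where "p k = (SOME p. (\<forall>t. bij_betw (p t) (G k) (G k)) \<and>
      (\<forall>l\<in>G k - {k}. (\<Sum>t<M. u l t (p t k)) \<le> (\<Sum>t<M. u l t (p t l))) \<and>
      (k = h \<longrightarrow> (\<exists>t<n. p t h = b t)))" for k
  have p: "bij_betw (p k t) (G k) (G k)"
      "l \<in> G k \<Longrightarrow> l \<noteq> k \<Longrightarrow> (\<Sum>t<M. u l t (p k t k)) \<le> (\<Sum>t<M. u l t (p k t l))"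
      "k = h \<Longrightarrow> \<exists>t<n. p k t h = b t"
    if k: "k < n" "k \<noteq> r" "head k = k" for k t l
    using someI_ex[OF perms[OF k]] unfolding p_def[symmetric] by auto
  define \<pi> where "\<pi> t v = (if v = r then r else p (head v) t v)" for t v
  have G: "v \<in> G (head v)" if "v < n" "v \<noteq> r" for v using that by (simp add: G_def)
  have \<pi>G: "\<pi> t v \<in> G (head v)" if "v < n" "v \<noteq> r" for t v
    using bij_betwE[OF p(1)[of "head v" t]] head[OF that] G[OF that] that by (auto simp: \<pi>_def)
  have \<pi>r: "\<pi> t r = r" for t by (simp add: \<pi>_def)
  have \<pi>v: "\<pi> t v < n" "\<pi> t v \<noteq> r" "head (\<pi> t v) = head v" if "v < n" "v \<noteq> r" for t v
    using \<pi>G[OF that, of t] by (auto simp: G_def)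
  have "inj_on (\<pi> t) {..<n}" for t
  proof (rule inj_onI)
    fix v w assume vw: "v \<in> {..<n}" "w \<in> {..<n}" "\<pi> t v = \<pi> t w"
    show "v = w"
    proof (cases "v = r \<or> w = r")
      case True
      then show ?thesis using vw \<pi>r \<pi>v(2) by (metis lessThan_iff)
    next
      case False
      then have "head v = head w" using vw \<pi>v(3) by (metis lessThan_iff)
      moreover have "inj_on (p (head v) t) (G (head v))"
        using p(1)[of "head v" t] head vw False by (auto simp: bij_betw_def)
      ultimately show ?thesis
        using vw False G[of v] G[of w] by (auto simp: \<pi>_def inj_on_def)
    qed
  qed
  moreover have "\<pi> t ` {..<n} \<subseteq> {..<n}" for t
    using \<pi>r \<pi>v(1) n by (metis image_subsetI lessThan_iff)
  ultimately have "bij_betw (\<pi> t) {..<n} {..<n}" for t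
    using endo_inj_surj[of "{..<n}" "\<pi> t"] by (simp add: bij_betw_def)
  moreover have "(\<Sum>t<M. u v t (\<pi> t (head v))) \<le> (\<Sum>t<M. u v t (\<pi> t v))" if "v < n" "v \<noteq> r" for v
    using p(2)[of "head v" v] head[OF that] G[OF that] that
    by (cases "v = head v") (simp_all add: \<pi>_def)
  moreover have "\<exists>t<n. \<pi> t h = b t" using p(3)[OF h] h by (simp add: \<pi>_def)
  ultimately show ?thesis using \<pi>r \<pi>v by blast
qed

text \<open>The inequalities are the two directions of the edges between \<open>v\<close> and
  \<open>head v\<close> and between \<open>head v\<close> and \<open>r\<close>, matching the list of
  edges in \<open>tree_heads\<close>.\<close>

definition fair_pieces :: "nat \<Rightarrow> nat \<Rightarrow> (nat \<Rightarrow> nat) \<Rightarrow> real set \<Rightarrow> (nat \<Rightarrow> real \<Rightarrow> real) \<Rightarrow>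
    (nat \<Rightarrow> real set) \<Rightarrow> bool" where
  "fair_pieces n r head P F A \<longleftrightarrow>
     (\<forall>a<n. piece P (A a)) \<and> disjoint_family_on A {..<n} \<and> (\<Union>a<n. A a) = {0<..1} \<and>
     (\<forall>v<n. v \<noteq> r \<longrightarrow> val (F v) P (A (head v)) \<le> val (F v) P (A v) \<and>
        val (F (head v)) P (A v) \<le> val (F (head v)) P (A (head v)) \<and>
        val (F r) P (A (head v)) \<le> val (F r) P (A r) \<and>
        val (F (head v)) P (A r) \<le> val (F (head v)) P (A (head v)))"

text \<open>Agent \<open>a\<close> receives slot \<open>\<pi> t a\<close> of every round, and the
  group of \<open>h\<close> also shares the leftover. Leaves are content by the exchange, heads
  because all slots of their group and R are worth the same to them, and \<open>r\<close> because
  its advantage over \<open>h\<close> covers the whole leftover.\<close>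

lemma combine_rounds:
  assumes st: "state n P F" and n: "2 \<le> n" and r: "r < n"
    and head: "\<And>v. v < n \<Longrightarrow> v \<noteq> r \<Longrightarrow> head v < n \<and> head v \<noteq> r \<and> head (head v) = head v"
    and gr: "good_rounds n r head P F (n + T) Q b"
    and T: "(1 - 1 / real n) ^ T \<le> 1 / real n"
    and h: "h < n" "h \<noteq> r" "head h = h"
    and cnt: "card {v \<in> {..<n} - {r}. head v = h} < card {t \<in> {..<n}. head (b t) = h}"
    and Z: "\<And>k. k \<in> {v \<in> {..<n} - {r}. head v = h} \<Longrightarrow> piece P (Z k) \<and> val (F h) P (Z k) = z"
      "(\<Union>k\<in>{v \<in> {..<n} - {r}. head v = h}. Z k) = leftover n Q (n + T)"
      "disjoint_family_on Z {v \<in> {..<n} - {r}. head v = h}"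
  shows "\<exists>A. fair_pieces n r head P F A"
proof -
  define M where "M = n + T"
  define G where "G = {v \<in> {..<n} - {r}. head v = h}"
  note gr = gr[folded M_def] and cnt = cnt[folded G_def] and Z = Z[folded M_def G_def]
  let ?V = "\<lambda>i. val (F i) P"
  have mk: "marks P" and cdf: "\<And>i. i < n \<Longrightarrow> cdf (F i)" using st by (auto simp: state_def)
  have R: "good_round n r head P F (leftover n Q t) (Q t) (b t)" if "t < M" for t
    using gr that by (simp add: good_rounds_def)
  have pQ: "piece P (Q t v)" if "t < M" "v < n" for t v using good_rounds_piece[OF gr that] .
  have hG: "h \<in> G" and finG: "finite G" using h by (auto simp: G_def)
  have bn: "b t < n \<and> b t \<noteq> r" if "t < M" for t using R[OF that] by (simp add: good_round_def)
  \<comment> \<open>The exchange lemma expects a value of \<open>b\<close> for every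
    \<open>t\<close>; beyond the last round \<open>h\<close> is an admissible default, and the first
    \<open>n\<close> rounds are unchanged.\<close>
  define b' where "b' t = (if t < M then b t else h)" for t
  have "{t \<in> {..<n}. head (b t) = h} = {t \<in> {..<n}. head (b' t) = h}"
    by (auto simp: b'_def M_def)
  moreover have "b' t < n \<and> b' t \<noteq> r" for t using bn h by (simp add: b'_def)
  moreover have "n \<le> M" by (simp add: M_def)
  ultimately have "\<exists>\<pi>. (\<forall>t. bij_betw (\<pi> t) {..<n} {..<n} \<and> \<pi> t r = r \<and>
        (\<forall>v<n. v \<noteq> r \<longrightarrow> \<pi> t v \<noteq> r \<and> head (\<pi> t v) = head v)) \<and>
     (\<forall>v<n. v \<noteq> r \<longrightarrow> (\<Sum>t<M. ?V v (Q t (\<pi> t (head v)))) \<le> (\<Sum>t<M. ?V v (Q t (\<pi> t v)))) \<and>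
     (\<exists>t<n. \<pi> t h = b' t)"
    using r head h cnt unfolding G_def by (intro good_rounds_exchange) auto
  then obtain \<pi> where
      "\<forall>t. bij_betw (\<pi> t) {..<n} {..<n} \<and> \<pi> t r = r \<and>
        (\<forall>v<n. v \<noteq> r \<longrightarrow> \<pi> t v \<noteq> r \<and> head (\<pi> t v) = head v)"
      "\<forall>v<n. v \<noteq> r \<longrightarrow> (\<Sum>t<M. ?V v (Q t (\<pi> t (head v)))) \<le> (\<Sum>t<M. ?V v (Q t (\<pi> t v)))"
    and ex0: "\<exists>t<n. \<pi> t h = b' t" by blast
  then have \<pi>: "\<And>t. bij_betw (\<pi> t) {..<n} {..<n}" "\<And>t. \<pi> t r = r"
      "\<And>t v. v < n \<Longrightarrow> v \<noteq> r \<Longrightarrow> \<pi> t v \<noteq> r" "\<And>t v. v < n \<Longrightarrow> v \<noteq> r \<Longrightarrow> head (\<pi> t v) = head v"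
      "\<And>v. v < n \<Longrightarrow> v \<noteq> r \<Longrightarrow>
        (\<Sum>t<M. ?V v (Q t (\<pi> t (head v)))) \<le> (\<Sum>t<M. ?V v (Q t (\<pi> t v)))"
    by auto
  obtain t0 where t0: "t0 < n" "t0 < M" "\<pi> t0 h = b t0" using ex0 by (auto simp: b'_def M_def)
  have \<pi>n: "\<pi> t v < n" if "v < n" for t v using bij_betwE[OF \<pi>(1)] that by auto
  have insG: "insert h (G - {h}) = G" using hG by auto
  have "card G = Suc (card (G - {h}))" using card_Suc_Diff1[OF finG hG] by simp
  \<comment> \<open>The shares \<open>Z k\<close> are equal for \<open>h\<close>, so
    \<open>h\<close> may choose last, and neither \<open>h\<close> nor a leaf envies the other over
    the leftover.\<close>
  then obtain \<rho> where \<rho>: "bij_betw \<rho> G G" "\<forall>l\<in>G - {h}. ?V l (Z (\<rho> h)) \<le> ?V l (Z (\<rho> l))"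
    using sequential_choice[of "G - {h}" h G "\<lambda>l s. ?V l (Z s)"] finG insG by auto
  have \<rho>G: "\<rho> v \<in> G" if "v \<in> G" for v using bij_betwE[OF \<rho>(1)] that by auto
  define X where "X a = (if a \<in> G then Z (\<rho> a) else {})" for a
  define A where "A a = (\<Union>t<M. Q t (\<pi> t a)) \<union> X a" for a
  have X_sub: "X a \<subseteq> leftover n Q M" for a using Z(2) \<rho>G by (auto simp: X_def)
  have Q_left: "Q t s \<inter> leftover n Q M = {}" if "t < M" "s < n" for t s
    using that by (auto simp: leftover_def)
  have Q_dis: "Q t (\<pi> t a) \<inter> Q t' (\<pi> t' a') = {}"
    if "t < M" "t' < M" "a < n" "a' < n" "(t, a) \<noteq> (t', a')" for t t' a a'
  proof (rule good_rounds_slots_disjoint[OF gr])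
    show "(t, \<pi> t a) \<noteq> (t', \<pi> t' a')"
      using that bij_betw_imp_inj_on[OF \<pi>(1)[of t]] by (auto simp: inj_on_def)
  qed (use that \<pi>n in auto)
  have X_dis: "X a \<inter> X a' = {}" if "a \<noteq> a'" for a a'
  proof (cases "a \<in> G \<and> a' \<in> G")
    case True
    then have "\<rho> a \<noteq> \<rho> a'" using that bij_betw_imp_inj_on[OF \<rho>(1)] by (auto simp: inj_on_def)
    then show ?thesis using disjoint_family_onD[OF Z(3), of "\<rho> a" "\<rho> a'"] \<rho>G True by (simp add: X_def)
  qed (auto simp: X_def)
  have pX: "piece P (X a)" for a using Z(1) \<rho>G by (simp add: X_def piece_empty)
  have pA: "piece P (A a)" if "a < n" for a
    unfolding A_def using pQ \<pi>n that pX by (intro piece_Un piece_UN) auto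
  have "disjoint_family_on A {..<n}"
    unfolding disjoint_family_on_def
  proof (intro ballI impI)
    fix a a' assume a: "a \<in> {..<n}" "a' \<in> {..<n}" "a \<noteq> a'"
    have 1: "Q t (\<pi> t c) \<inter> X c' = {}" if "t < M" "c < n" for t c c'
      using Q_left[of t "\<pi> t c"] \<pi>n X_sub[of c'] that by blast
    have "(\<Union>t<M. Q t (\<pi> t a)) \<inter> (\<Union>t<M. Q t (\<pi> t a')) = {}"
      using Q_dis[of _ _ a a'] a by fastforce
    moreover have "(\<Union>t<M. Q t (\<pi> t a)) \<inter> X a' = {}" "(\<Union>t<M. Q t (\<pi> t a')) \<inter> X a = {}"
      using 1 a by auto
    ultimately show "A a \<inter> A a' = {}" using X_dis[OF a(3)] unfolding A_def by blast
  qed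
  moreover have "(\<Union>a<n. A a) = {0<..1}"
  proof
    show "(\<Union>a<n. A a) \<subseteq> {0<..1}" using pA piece_subset by blast
    show "{0<..1} \<subseteq> (\<Union>a<n. A a)"
    proof
      fix x :: real assume x: "x \<in> {0<..1}"
      show "x \<in> (\<Union>a<n. A a)"
      proof (cases "x \<in> leftover n Q M")
        case True
        then obtain k where k: "k \<in> G" "x \<in> Z k" using Z(2) by blast
        then obtain a where "a \<in> G" "k = \<rho> a" using bij_betw_imp_surj_on[OF \<rho>(1)] by blast
        then show ?thesis using k by (auto simp: A_def X_def G_def)
      next
        case False
        then obtain t s where ts: "t < M" "s < n" "x \<in> Q t s" using x by (auto simp: leftover_def)
        then obtain a where "a < n" "s = \<pi> t a"
          using bij_betw_imp_surj_on[OF \<pi>(1)[of t]] by blast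
        then show ?thesis using ts by (auto simp: A_def)
      qed
    qed
  qed
  moreover have VA: "val f P (A a) = (\<Sum>t<M. val f P (Q t (\<pi> t a))) + val f P (X a)" if "a < n" for f a
  proof -
    have "(\<Union>t<M. Q t (\<pi> t a)) \<inter> X a = {}"
      using Q_left X_sub[of a] \<pi>n[OF that] by blast
    then have "val f P (A a) = val f P (\<Union>t<M. Q t (\<pi> t a)) + val f P (X a)"
      unfolding A_def by (rule val_Un[OF mk])
    also have "val f P (\<Union>t<M. Q t (\<pi> t a)) = (\<Sum>t<M. val f P (Q t (\<pi> t a)))"
      using Q_dis[of _ _ a a] that by (intro val_UN[OF mk]) auto
    finally show ?thesis .
  qed
  have X_out: "val f P (X a) = 0" if "a \<notin> G" for f a using that by (simp add: X_def val_empty)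
  have rG: "r \<notin> G" by (simp add: G_def)
  have slot: "?V (head v) (Q t (\<pi> t v)) = ?V (head v) (Q t r)" if "v < n" "v \<noteq> r" "t < M" for v t
    using R[OF that(3)] \<pi>n[OF that(1)] \<pi>(3,4)[OF that(1,2)] unfolding good_round_def by metis
  have slot_root: "?V r (Q t s) \<le> ?V r (Q t r)" if "s < n" "t < M" for s t
    using R[OF that(2)] that(1) by (simp add: good_round_def)
  have leaf: "?V v (A (head v)) \<le> ?V v (A v)" if v: "v < n" "v \<noteq> r" for v
  proof -
    have "?V v (X (head v)) \<le> ?V v (X v)"
    proof (cases "v \<in> G \<and> v \<noteq> h")
      case True
      then show ?thesis using \<rho>(2) hG by (auto simp: X_def G_def)
    next
      case False
      then show ?thesis using v head[OF v] h X_out[of "head v" "F v"] X_out[of v "F v"]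
        by (auto simp: G_def)
    qed
    then show ?thesis using VA[of v] VA[of "head v"] \<pi>(5)[OF v] v head[OF v] by (simp add: add_mono)
  qed
  have head_leaf: "?V (head v) (A v) \<le> ?V (head v) (A (head v))" if v: "v < n" "v \<noteq> r" for v
  proof -
    have hv: "head v < n" "head v \<noteq> r" "head (head v) = head v" using head[OF v] by auto
    have "?V (head v) (X v) = ?V (head v) (X (head v))"
    proof (cases "v \<in> G")
      case True
      then have "head v = h" by (simp add: G_def)
      then show ?thesis using True hG Z(1) \<rho>G by (simp add: X_def)
    next
      case False
      then have "head v \<notin> G" using hv v by (simp add: G_def)
      then show ?thesis using False X_out by simp
    qed
    moreover have "(\<Sum>t<M. ?V (head v) (Q t (\<pi> t v))) = (\<Sum>t<M. ?V (head v) (Q t (\<pi> t (head v))))"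
      using slot[OF v] slot[OF hv(1,2)] hv(3) by (intro sum.cong) auto
    ultimately show ?thesis using VA v hv by simp
  qed
  have head_root: "?V (head v) (A r) \<le> ?V (head v) (A (head v))" if v: "v < n" "v \<noteq> r" for v
  proof -
    have hv: "head v < n" "head v \<noteq> r" "head (head v) = head v" using head[OF v] by auto
    have "(\<Sum>t<M. ?V (head v) (Q t r)) = (\<Sum>t<M. ?V (head v) (Q t (\<pi> t (head v))))"
      using slot[OF hv(1,2)] hv(3) by (intro sum.cong) auto
    then show ?thesis
      using VA[OF hv(1)] VA[OF r] \<pi>(2) X_out[OF rG] val_nonneg[OF mk cdf[OF hv(1)] pX] by simp
  qed
  have root: "?V r (A (head v)) \<le> ?V r (A r)" if v: "v < n" "v \<noteq> r" for v
  proof (cases "head v = h")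
    case False
    then have "head v \<notin> G" using head[OF v] by (simp add: G_def)
    moreover have "(\<Sum>t<M. ?V r (Q t (\<pi> t (head v)))) \<le> (\<Sum>t<M. ?V r (Q t r))"
      using slot_root \<pi>n head[OF v] by (intro sum_mono) auto
    ultimately show ?thesis using VA[of "head v"] VA[of r] r head[OF v] \<pi>(2) X_out rG by simp
  next
    case True
    \<comment> \<open>\<open>gap t\<close> is the advantage of \<open>r\<close> over
      \<open>h\<close> in round \<open>t\<close>; in round \<open>t0\<close>, where \<open>h\<close>
      holds \<open>b t0\<close>, it controls everything left over afterwards.\<close>
    define gap where "gap t = ?V r (Q t r) - ?V r (Q t (\<pi> t h))" for t
    have gap0: "0 \<le> gap t" if "t < M" for t using slot_root[OF \<pi>n[OF h(1)] that] by (simp add: gap_def)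
    let ?L = "\<lambda>t. ?V r (leftover n Q t)"
    have pL: "piece P (leftover n Q t)" if "t \<le> M" for t
      using pQ that by (intro piece_leftover) auto
    have L0: "0 \<le> ?L t" if "t \<le> M" for t using val_nonneg[OF mk cdf[OF r] pL[OF that]] .
    have "?V r (X h) \<le> ?L M" using val_mono[OF mk cdf[OF r] pL pX X_sub] by simp
    also have "?L M \<le> (1 - 1 / real n) ^ (M - Suc t0) * ?L (Suc t0)"
      using leftover_decay[OF st n r gr, of "Suc t0" "M - Suc t0"] t0 by simp
    \<comment> \<open>Since \<open>t0 < n\<close>, at least \<open>T\<close> rounds follow round
      \<open>t0\<close>.\<close>
    also have "\<dots> \<le> (1 - 1 / real n) ^ T * ?L (Suc t0)"
      using t0 n L0 by (intro mult_right_mono power_decreasing) (auto simp: M_def)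
    also have "\<dots> \<le> 1 / real n * ?L (Suc t0)"
      using T t0 L0 by (intro mult_right_mono) auto
    \<comment> \<open>This is the last inequality of \<open>good_round\<close> for round
      \<open>t0\<close>; the factor \<open>1 / n\<close> gained by the decay outweighs its
      \<open>n - 1\<close>.\<close>
    also have "\<dots> \<le> 1 / real n * ((real n - 1) * gap t0)"
      using R[OF t0(2)] t0 n
      by (intro mult_left_mono) (auto simp: good_round_def gap_def leftover_Suc)
    also have "\<dots> = gap t0 * ((real n - 1) / real n)" by simp
    also have "\<dots> \<le> gap t0 * 1"
      using gap0[OF t0(2)] n by (intro mult_left_mono) auto
    also have "gap t0 * 1 \<le> (\<Sum>t<M. gap t)" using member_le_sum[of t0 "{..<M}" gap] gap0 t0 by simp
    also have "\<dots> = ?V r (A r) - (\<Sum>t<M. ?V r (Q t (\<pi> t h)))"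
      using VA[OF r] \<pi>(2) X_out[OF rG] by (simp add: gap_def sum_subtractf)
    finally show ?thesis using VA[OF h(1)] True by simp
  qed
  ultimately show ?thesis using pA leaf head_leaf head_root root
    unfolding fair_pieces_def by (intro exI[of _ A]) blast
qed

text \<open>The first \<open>n\<close> rounds supply the pigeonhole argument, and \<open>T\<close>
  further ones make the decay sufficient. Each costs \<open>2 * n\<close> cuts, and dividing the
  leftover within the chosen group costs at most \<open>n\<close>.\<close>

lemma reaches_allocation:
  assumes st: "state n P F" and n: "2 \<le> n" and r: "r < n"
    and head: "\<And>v. v < n \<Longrightarrow> v \<noteq> r \<Longrightarrow> head v < n \<and> head v \<noteq> r \<and> head (head v) = head v"
    and T: "(1 - 1 / real n) ^ T \<le> 1 / real n"
  shows "reaches n (\<lambda>P F. \<exists>A. fair_pieces n r head P F A) ((n + T) * (2 * n) + n) P F"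
    (is "reaches n ?Q _ P F")
proof (rule reaches_bind[OF reaches_rounds[OF st n r] st])
  show "head v < n" if "v < n" "v \<noteq> r" for v using head that by blast
  fix P' F' assume ref: "refines n P F P' F'" and "\<exists>Q b. good_rounds n r head P' F' (n + T) Q b"
  then obtain Q b where gr: "good_rounds n r head P' F' (n + T) Q b" by blast
  have st': "state n P' F'" using ref by (rule refines_state)
  have b: "b t < n" "b t \<noteq> r" if "t < n" for t
    using gr that by (auto simp: good_rounds_def good_round_def)
  \<comment> \<open>There are \<open>n\<close> rounds but only \<open>n - 1\<close> agents besides
    \<open>r\<close>, so some group contains \<open>b\<close> in more of these rounds than it has
    members.\<close>
  have "card ({..<n} - {r}) < card {..<n}" using r by (intro psubset_card_mono) auto
  then obtain h where hmem: "h \<in> (\<lambda>t. head (b t)) ` {..<n} \<union> head ` ({..<n} - {r})"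
    and cnt: "card {v \<in> {..<n} - {r}. head v = h} < card {t \<in> {..<n}. head (b t) = h}"
    using pigeonhole_fibres[of "{..<n}" "{..<n} - {r}" "\<lambda>t. head (b t)" head] by auto
  have h: "h < n" "h \<noteq> r" "head h = h" using hmem b head by auto
  let ?G = "{v \<in> {..<n} - {r}. head v = h}"
  define N where "N = card ?G"
  let ?z = "val (F' h) P' (leftover n Q (n + T)) / real N"
  have pL: "piece P' (leftover n Q (n + T))"
    using good_rounds_piece[OF gr] by (rule piece_leftover)
  have G: "finite ?G" "?G \<noteq> {}" using h by auto
  have "0 < N" unfolding N_def card_gt_0_iff using G by blast
  have "0 \<le> ?z"
    using st' h pL by (intro divide_nonneg_nonneg val_nonneg) (auto simp: state_def)
  moreover have "(\<Sum>k\<in>?G. ?z) = real N * ?z" unfolding N_def by (rule sum_constant)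
  ultimately have "reaches n (\<lambda>P' F'. \<exists>Z. (\<forall>k\<in>?G. piece P' (Z k) \<and> val (F' h) P' (Z k) = ?z) \<and>
      (\<Union>k\<in>?G. Z k) = leftover n Q (n + T) \<and> disjoint_family_on Z ?G) (card ?G) P' F'"
    using \<open>0 < N\<close> by (intro reaches_divide[OF G st' h(1) pL, of "\<lambda>_. ?z"]) simp_all
  then have "reaches n ?Q (card ?G) P' F'"
  proof (rule reaches_conseq[OF _ st'])
    fix P'' F'' assume ref': "refines n P' F' P'' F''"
      and "\<exists>Z. (\<forall>k\<in>?G. piece P'' (Z k) \<and> val (F'' h) P'' (Z k) = ?z) \<and>
      (\<Union>k\<in>?G. Z k) = leftover n Q (n + T) \<and> disjoint_family_on Z ?G"
    then obtain Z where Z: "\<And>k. k \<in> ?G \<Longrightarrow> piece P'' (Z k) \<and> val (F'' h) P'' (Z k) = ?z"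
      "(\<Union>k\<in>?G. Z k) = leftover n Q (n + T)" "disjoint_family_on Z ?G" by blast
    have "good_rounds n r head P'' F'' (n + T) Q b"
      using head gr by (intro good_rounds_refines[OF ref' st' r]) auto
    from combine_rounds[OF refines_state[OF ref'] n r head this T h cnt Z]
    show "?Q P'' F''" by blast
  qed
  moreover have "card ?G \<le> n" using card_mono[of "{..<n}" ?G] by auto
  ultimately show "reaches n ?Q n P' F'"
    using reaches_weaken[of n ?Q "card ?G" P' F' "n - card ?G"] by simp
qed

section \<open>The number of queries\<close>

theorem theorem3:
  "\<exists>C :: real. \<forall>n :: nat. \<forall>E. n \<ge> 2 \<and> tree_depth_le2 n E \<longrightarrow>
     (\<exists>P :: protocol. \<forall>vs. (\<forall>i < n. valuation (vs i)) \<longrightarrow>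
        succeeds n E vs P (C * real n ^ 3 * ln (real n)) (C * real n ^ 4 * ln (real n)))"
proof (intro exI[of _ 7] allI impI, elim conjE)
  fix n :: nat and E assume n: "2 \<le> n" and tree: "tree_depth_le2 n E"
  from tree_heads[OF tree] obtain r head where r: "r < n"
    and "\<forall>v<n. v \<noteq> r \<longrightarrow> head v < n \<and> head v \<noteq> r \<and> head (head v) = head v"
    and "\<forall>i j. E i j \<longrightarrow> (\<exists>v<n. v \<noteq> r \<and>
       (i = r \<and> j = head v \<or> i = head v \<and> j = r \<or> i = v \<and> j = head v \<or> i = head v \<and> j = v))"
    by (elim exE conjE)
  then have head: "\<And>v. v < n \<Longrightarrow> v \<noteq> r \<Longrightarrow> head v < n \<and> head v \<noteq> r \<and> head (head v) = head v"
    and edge: "\<And>i j. E i j \<Longrightarrow> \<exists>v<n. v \<noteq> r \<and>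
       (i = r \<and> j = head v \<or> i = head v \<and> j = r \<or> i = v \<and> j = head v \<or> i = head v \<and> j = v)"
    by simp_all
  let ?L = "ln (real n)"
  \<comment> \<open>\<open>(1 - 1 / n) ^ T\<close> is at most \<open>exp (- T / n)\<close>, which
    drops to \<open>1 / n\<close> once \<open>T\<close> reaches \<open>n ln n\<close>.\<close>
  define T where "T = nat \<lceil>real n * ?L\<rceil>"
  \<comment> \<open>A positive lower bound on the logarithm lets \<open>n^3 ln n\<close> absorb the
    lower-order terms already for \<open>n = 2\<close>.\<close>
  have "ln (1 / 2 :: real) \<le> 1 / 2 - 1" by (rule ln_le_minus_one) simp
  then have "1 / 2 \<le> ln (2 :: real)" by (simp add: ln_div)
  also have "\<dots> \<le> ?L" using n by simp
  finally have L: "1 / 2 \<le> ?L" .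
  have T: "real n * ?L \<le> real T" "real T \<le> real n * ?L + 1"
  proof -
    have "0 \<le> real n * ?L" using L by simp
    then have "real T = of_int \<lceil>real n * ?L\<rceil>" unfolding T_def by simp
    then show "real n * ?L \<le> real T" "real T \<le> real n * ?L + 1" by linarith+
  qed
  have decay: "(1 - 1 / real n) ^ T \<le> 1 / real n"
  proof -
    have "(1 - 1 / real n) ^ T \<le> exp (- 1 / real n) ^ T"
      using exp_ge_add_one_self[of "- 1 / real n"] n by (intro power_mono) auto
    also have "\<dots> = exp (- real T / real n)" by (simp flip: exp_of_nat_mult)
    also have "\<dots> \<le> exp (- ?L)" using T(1) n by (simp add: field_simps)
    also have "\<dots> = 1 / real n" using n by (simp add: exp_minus inverse_eq_divide)
    finally show ?thesis .
  qed
  \<comment> \<open>The identity is an arbitrary initial profile: at the marks 0 and 1 all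
    valuations agree by normalization, so every profile is consistent with it.\<close>
  let ?F = "\<lambda>(i::nat) x::real. x" and ?c = "(n + T) * (2 * n) + n"
  have st: "state n {0, 1} ?F" by (auto simp: state_def marks_def cdf_def)
  have "solvable n E (consistent n {0, 1} ?F) (real ?c) (real (n * ?c))"
  proof (rule reaches_solvable[OF reaches_allocation[OF st n r head decay] st])
    fix P F assume st: "state n P F" and "\<exists>A. fair_pieces n r head P F A"
    then obtain A where A: "\<forall>a<n. piece P (A a)" "disjoint_family_on A {..<n}" "(\<Union>a<n. A a) = {0<..1}"
      "\<forall>v<n. v \<noteq> r \<longrightarrow> val (F v) P (A (head v)) \<le> val (F v) P (A v) \<and>
       val (F (head v)) P (A v) \<le> val (F (head v)) P (A (head v)) \<and>
       val (F r) P (A (head v)) \<le> val (F r) P (A r) \<and>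
       val (F (head v)) P (A r) \<le> val (F (head v)) P (A (head v))"
      unfolding fair_pieces_def by blast
    show "\<exists>p ow. \<forall>vs\<in>consistent n P F. valid_alloc n p ow \<and> locally_envy_free n E vs p ow"
    proof (rule pieces_output[OF st _ A(2,3)])
      show "i < n \<and> j < n \<and> val (F i) P (A j) \<le> val (F i) P (A i)" if "E i j" for i j
        using edge[OF that] A(4) head r by blast
    qed (use A(1) in auto)
  qed
  then obtain Pr where Pr: "\<And>vs. vs \<in> consistent n {0, 1} ?F \<Longrightarrow> succeeds n E vs Pr (real ?c) (real (n * ?c))"
    unfolding solvable_def by blast
  have "real ?c \<le> 7 * real n ^ 3 * ?L"
  proof -
    have 1: "1 \<le> real n * ?L" using mult_mono[of 2 "real n" "1 / 2" ?L] n L by simp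
    have 2: "real n ^ 2 \<le> real n ^ 3 * ?L"
      using mult_left_mono[OF 1, of "real n ^ 2"] by (simp add: power2_eq_square power3_eq_cube)
    have 3: "real n ^ 2 * ?L \<le> real n ^ 3 * ?L"
      using n L by (intro mult_right_mono power_increasing) auto
    have 4: "real n \<le> real n ^ 2" using n by (simp add: power2_eq_square)
    have "real ?c = 2 * real n * (real n + real T) + real n" by (simp add: algebra_simps)
    also have "\<dots> \<le> 2 * real n * (real n + (real n * ?L + 1)) + real n"
      using T(2) by (intro add_mono mult_left_mono) auto
    \<comment> \<open>Each of \<open>n^2\<close>, \<open>n^2 ln n\<close> and \<open>n\<close> is at
      most \<open>n^3 ln n\<close>, so the coefficients 2, 2 and 3 add up to the constant 7.\<close>
    also have "\<dots> = 2 * real n ^ 2 + 2 * (real n ^ 2 * ?L) + 3 * real n"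
      by (simp add: algebra_simps power2_eq_square)
    finally show ?thesis using 2 3 4 by linarith
  qed
  moreover from this have "real (n * ?c) \<le> 7 * real n ^ 4 * ?L"
    using mult_left_mono[of "real ?c" "7 * real n ^ 3 * ?L" "real n"]
    by (simp add: power4_eq_xxxx power3_eq_cube ac_simps)
  moreover have "vs \<in> consistent n {0, 1} ?F" if "\<forall>i<n. valuation (vs i)" for vs
    using that valuation_cdf by (auto simp: consistent_def cdf_def)
  ultimately show "\<exists>P. \<forall>vs. (\<forall>i<n. valuation (vs i)) \<longrightarrow>
      succeeds n E vs P (7 * real n ^ 3 * ?L) (7 * real n ^ 4 * ?L)"
    using succeeds_mono[OF Pr] by blast
qed

end
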